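(* Let $G_0$ be the $17$-vertex graph consisting of three pairwise disjoint cliques $C_1,C_2,C_3\cong K_5$ and two further vertices $u,v$, where every vertex of $C_1$ is adjacent to every vertex of $C_2$, every vertex of $C_2$ is adjacent to every vertex of $C_3$, there are no edges between $C_1$ and $C_3$, $u$ is adjacent to exactly the vertices of $C_1$, and $v$ is adjacent to exactly the vertices of $C_3$ (so $uv$ is not an edge). Let $G_1=G_0+uv$. Then there exist unique numbers \[ \alpha\in(2,3),\qquad \beta\in(3,4) \] such that, for every real $p\ge1$, \[ \mathcal E_p^+(G_1)<\mathcal E_p^+(G_0)\quad\Longleftrightarrow\quad \alpha<p<\beta . \] Numerically, $\alpha\approx 2.4322519338217608578$ and $\beta\approx 3.0408359954191677907$.
   Context: For a finite simple graph $G$ with adjacency eigenvalues $\lambda_i(G)$ (the eigenvalues of its adjacency matrix, counted with multiplicity) and a real number $p\ge 1$, the positive $p$-energy is \[ \mathcal E_p^+(G)=\sum_{\lambda_i(G)>0}\lambda_i(G)^p . \] $G_0+uv$ denotes the graph obtained from $G_0$ by adding the edge $uv$. The characteristic polynomials of the adjacency matrices of the two graphs are \[ \chi_{G_0}(x)=(x+1)^{13}(x-5)(x^3-8x^2-39x+20),\qquad \chi_{G_1}(x)=(x+1)^{12}(x^2-3x-9)(x^3-9x^2-31x+54). \] *)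

theory Defs
  imports
    Complex_Main
    "Graph_Theory.Pair_Digraph"
    "Jordan_Normal_Form.Char_Poly"
begin

text \<open>
  A finite simple graph is a \<^locale>\<open>pair_graph\<close>: a finite, loop-free, symmetric pair digraph.
  An edge \<open>uv\<close> is represented by the two arcs \<open>(u, v)\<close> and \<open>(v, u)\<close>.
\<close>

definition add_edge :: "'a pair_pre_digraph \<Rightarrow> 'a \<Rightarrow> 'a \<Rightarrow> 'a pair_pre_digraph" where
  "add_edge G u v = G\<lparr>parcs := parcs G \<union> {(u, v), (v, u)}\<rparr>"

text \<open>
  Matrices are indexed by natural numbers, so the adjacency matrix is taken with respect to
  an enumeration \<open>vs\<close> of the vertices. Different enumerations give
  permutation-similar matrices, hence the same eigenvalues with the same multiplicities;
  \<open>adjacency_matrix\<close> fixes an arbitrary one.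
\<close>

definition adjacency_matrix_wrt :: "'a list \<Rightarrow> 'a pair_pre_digraph \<Rightarrow> real mat" where
  "adjacency_matrix_wrt vs G =
     mat (length vs) (length vs) (\<lambda>(i, j). if (vs ! i, vs ! j) \<in> parcs G then 1 else 0)"

definition adjacency_matrix :: "'a pair_pre_digraph \<Rightarrow> real mat" where
  "adjacency_matrix G =
     adjacency_matrix_wrt (SOME vs. distinct vs \<and> set vs = pverts G) G"

text \<open>
  Summing over the adjacency eigenvalues with multiplicity means weighting each distinct
  eigenvalue by its order as a root of the characteristic polynomial. All eigenvalues are
  real since the matrix is symmetric, and the bases of \<open>powr\<close> are positive.
\<close>

definition positive_energy :: "real \<Rightarrow> 'a pair_pre_digraph \<Rightarrow> real" where
  "positive_energy p G =
     (\<Sum>x | eigenvalue (adjacency_matrix G) x \<and> x > 0.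
        real (order x (char_poly (adjacency_matrix G))) * x powr p)"

end

theory Submission
  imports Defs
begin

text \<open>
  After adding the identity, the adjacency matrix of either graph depends only on the five classes
  \<open>C1, C2, C3, {u}, {v}\<close> of its indices, so Sylvester's determinant identity reduces the
  characteristic polynomial to a determinant of size 5. With \<open>x1, x2, x3\<close> the positive eigenvalues
  of \<open>G1\<close> and \<open>y1, 5, y3\<close> those of \<open>G0\<close>, one has \<open>x1 > y1 > 5 > x2 > x3 > y3\<close>. The difference of
  the two energies is therefore an exponential sum in \<open>p\<close> with only three sign changes, and by
  Rolle's theorem it has at most three zeros. One of them is \<open>p = 0\<close>; the other two are
  \<open>\<alpha>\<close> and \<open>\<beta>\<close>, caught by the signs of the sum at four rational points, and these signs decide the
  sign of the sum everywhere on the positive axis.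
\<close>

section \<open>Characteristic polynomials\<close>

text \<open>One block matrix is multiplied by block triangular ones, from the right to expose
  \<open>y I - E F\<close> and from the left to expose \<open>y I - F E\<close>. Keeping powers of
  \<open>y\<close> on both sides avoids division, so the identity applies to polynomial
  entries.\<close>

lemma det_sylvester:
  fixes y :: "'a :: idom"
  assumes E: "E \<in> carrier_mat n m" and F: "F \<in> carrier_mat m n"
  shows "y ^ m * det (y \<cdot>\<^sub>m 1\<^sub>m n - E * F) = y ^ n * det (y \<cdot>\<^sub>m 1\<^sub>m m - F * E)"
proof -
  let ?M = "four_block_mat (y \<cdot>\<^sub>m 1\<^sub>m n) E F (1\<^sub>m m)"
  let ?R = "four_block_mat (1\<^sub>m n) (0\<^sub>m n m) (- F) (1\<^sub>m m)"
  let ?L = "four_block_mat (1\<^sub>m n) (0\<^sub>m n m) (- F) (y \<cdot>\<^sub>m 1\<^sub>m m)"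
  have carriers: "?M \<in> carrier_mat (n + m) (n + m)" "?R \<in> carrier_mat (n + m) (n + m)"
    "?L \<in> carrier_mat (n + m) (n + m)"
    using E F by auto
  have EF: "E * F \<in> carrier_mat n n" "F * E \<in> carrier_mat m m"
    using E F by auto
  then have sub: "y \<cdot>\<^sub>m 1\<^sub>m n - E * F \<in> carrier_mat n n" "y \<cdot>\<^sub>m 1\<^sub>m m - F * E \<in> carrier_mat m m"
    by (auto intro: minus_carrier_mat)
  have MR: "?M * ?R = four_block_mat (y \<cdot>\<^sub>m 1\<^sub>m n - E * F) E (0\<^sub>m m n) (1\<^sub>m m)"
    using E F
    by (subst mult_four_block_mat[of _ n n _ m _ m _ _ n _ m])
       (auto simp: minus_add_uminus_mat[of _ n n])
  have "- F * (y \<cdot>\<^sub>m 1\<^sub>m n) + y \<cdot>\<^sub>m 1\<^sub>m m * F = 0\<^sub>m m n"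
    using F by (intro eq_matI) (simp_all add: mult_smult_distrib[of _ m n _ n] mult_smult_assoc_mat[of _ m m _ n])
  moreover have "- F * E + y \<cdot>\<^sub>m 1\<^sub>m m * 1\<^sub>m m = y \<cdot>\<^sub>m 1\<^sub>m m - F * E"
    using E F EF by (intro eq_matI) (simp_all add: mult_smult_assoc_mat[of _ m m _ m])
  ultimately have LM: "?L * ?M = four_block_mat (y \<cdot>\<^sub>m 1\<^sub>m n) E (0\<^sub>m m n) (y \<cdot>\<^sub>m 1\<^sub>m m - F * E)"
    using E F
    by (subst mult_four_block_mat[of _ n n _ m _ m _ _ n _ m]) simp_all
  have "det (?M * ?R) = det (y \<cdot>\<^sub>m 1\<^sub>m n - E * F) * det (1\<^sub>m m :: 'a mat)"
    unfolding MR using sub by (intro det_four_block_mat_lower_left_zero[OF _ E refl]) simp_all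
  moreover have "det ?R = det (1\<^sub>m n :: 'a mat) * det (1\<^sub>m m :: 'a mat)"
    using F by (intro det_four_block_mat_upper_right_zero[OF _ refl]) simp_all
  ultimately have M: "det ?M = det (y \<cdot>\<^sub>m 1\<^sub>m n - E * F)"
    using det_mult[OF carriers(1,2)] by simp
  have "det (?L * ?M) = det (y \<cdot>\<^sub>m 1\<^sub>m n) * det (y \<cdot>\<^sub>m 1\<^sub>m m - F * E)"
    unfolding LM using sub by (intro det_four_block_mat_lower_left_zero[OF _ E refl]) simp_all
  moreover have "det ?L = det (1\<^sub>m n :: 'a mat) * det (y \<cdot>\<^sub>m 1\<^sub>m m)"
    using F by (intro det_four_block_mat_upper_right_zero[OF _ refl]) simp_all
  ultimately show ?thesis
    using det_mult[OF carriers(3,1)] M by simp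
qed

text \<open>With \<open>y = x + 1\<close>, the matrix \<open>x I - A\<close> is
  \<open>y I - (A + I)\<close>, and \<open>A + I\<close> factors through the classes:
  \<open>E\<close> records the class of each index, \<open>F\<close> the weights from each class to
  each index. Exchanging the factors leaves an \<open>m\<close> by \<open>m\<close> determinant in
  which the class sizes appear.\<close>

lemma char_poly_blowup:
  fixes G :: "'a pair_pre_digraph" and w :: "nat \<Rightarrow> nat \<Rightarrow> nat" and N :: "nat \<Rightarrow> nat"
  assumes \<kappa>: "\<And>x. x \<in> set vs \<Longrightarrow> \<kappa> x < m"
    and N: "\<And>k. k < m \<Longrightarrow> card {x \<in> set vs. \<kappa> x = k} = N k"
    and adj: "\<And>x y. x \<in> set vs \<Longrightarrow> y \<in> set vs \<Longrightarrow>
      of_bool ((x, y) \<in> parcs G) + of_bool (x = y) = w (\<kappa> x) (\<kappa> y)"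
    and vs: "distinct vs"
  shows "[:1, 1:] ^ m * char_poly (adjacency_matrix_wrt vs G) =
    [:1, 1:] ^ length vs * det (mat m m (\<lambda>(k, l). (if k = l then [:1, 1:] else 0) - of_nat (w k l * N l)))"
proof -
  let ?n = "length vs"
  define E :: "real poly mat" where "E = mat ?n m (\<lambda>(i, k). of_bool (\<kappa> (vs ! i) = k))"
  define F :: "real poly mat" where "F = mat m ?n (\<lambda>(k, j). of_nat (w k (\<kappa> (vs ! j))))"
  have EF: "E \<in> carrier_mat ?n m" "F \<in> carrier_mat m ?n"
    by (simp_all add: E_def F_def)
  have EFij: "(E * F) $$ (i, j) = of_nat (w (\<kappa> (vs ! i)) (\<kappa> (vs ! j)))" if "i < ?n" "j < ?n" for i j
  proof -
    have "(E * F) $$ (i, j) = (\<Sum>k = 0..<m. of_bool (\<kappa> (vs ! i) = k) * of_nat (w k (\<kappa> (vs ! j))))"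
      using that by (simp add: E_def F_def scalar_prod_def)
    also have "\<dots> = (\<Sum>k = 0..<m. if \<kappa> (vs ! i) = k then of_nat (w k (\<kappa> (vs ! j))) else 0)"
      by (intro sum.cong) simp_all
    also have "\<dots> = of_nat (w (\<kappa> (vs ! i)) (\<kappa> (vs ! j)))"
      using that \<kappa> by simp
    finally show ?thesis .
  qed
  have "char_poly_matrix (adjacency_matrix_wrt vs G) = [:1, 1:] \<cdot>\<^sub>m 1\<^sub>m ?n - E * F"
  proof (rule eq_matI)
    fix i j assume ij: "i < dim_row ([:1, 1:] \<cdot>\<^sub>m 1\<^sub>m ?n - E * F)" "j < dim_col ([:1, 1:] \<cdot>\<^sub>m 1\<^sub>m ?n - E * F)"
    then have ij: "i < ?n" "j < ?n" using EF by auto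
    show "char_poly_matrix (adjacency_matrix_wrt vs G) $$ (i, j) = ([:1, 1:] \<cdot>\<^sub>m 1\<^sub>m ?n - E * F) $$ (i, j)"
    proof -
      have "(of_nat (w (\<kappa> (vs ! i)) (\<kappa> (vs ! j))) :: real poly) =
          of_bool ((vs ! i, vs ! j) \<in> parcs G) + of_bool (i = j)"
        unfolding adj[OF nth_mem[OF ij(1)] nth_mem[OF ij(2)], symmetric]
        using ij vs by (simp add: nth_eq_iff_index_eq)
      then show ?thesis
        using ij EF EFij[OF ij]
        by (simp add: char_poly_matrix_def adjacency_matrix_wrt_def one_pCons of_bool_def)
    qed
  qed (use EF in \<open>auto simp: char_poly_matrix_def adjacency_matrix_wrt_def\<close>)
  then have "char_poly (adjacency_matrix_wrt vs G) = det ([:1, 1:] \<cdot>\<^sub>m 1\<^sub>m ?n - E * F)"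
    by (simp add: char_poly_def)
  moreover have "[:1, 1:] \<cdot>\<^sub>m 1\<^sub>m m - F * E = mat m m (\<lambda>(k, l). (if k = l then [:1, 1:] else 0) - of_nat (w k l * N l))"
  proof (rule eq_matI)
    fix k l assume "k < dim_row (mat m m (\<lambda>(k, l). (if k = l then [:1, 1:] else 0) - of_nat (w k l * N l) :: real poly))"
      "l < dim_col (mat m m (\<lambda>(k, l). (if k = l then [:1, 1:] else 0) - of_nat (w k l * N l) :: real poly))"
    then have kl: "k < m" "l < m" by auto
    have "(F * E) $$ (k, l) = (\<Sum>i<?n. of_nat (w k (\<kappa> (vs ! i))) * of_bool (\<kappa> (vs ! i) = l))"
      using kl by (simp add: E_def F_def scalar_prod_def lessThan_atLeast0)
    also have "\<dots> = (\<Sum>i<?n. of_nat (w k l) * of_bool (\<kappa> (vs ! i) = l))"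
      by (intro sum.cong) auto
    also have "\<dots> = of_nat (w k l) * of_nat (card {i \<in> {..<?n}. \<kappa> (vs ! i) = l})"
      by (simp flip: sum_distrib_left add: Int_def)
    also have "card {i \<in> {..<?n}. \<kappa> (vs ! i) = l} = card {x \<in> set vs. \<kappa> x = l}"
      using vs by (intro bij_betw_same_card[of "(!) vs"])
        (auto simp: bij_betw_def inj_on_def nth_eq_iff_index_eq in_set_conv_nth)
    finally show "([:1, 1:] \<cdot>\<^sub>m 1\<^sub>m m - F * E) $$ (k, l) =
        mat m m (\<lambda>(k, l). (if k = l then [:1, 1:] else 0) - of_nat (w k l * N l)) $$ (k, l)"
      using kl EF N[of l] by (simp add: one_pCons)
  qed (use EF in auto)
  ultimately show ?thesis
    using det_sylvester[OF EF, of "[:1, 1:]"] by simp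
qed

text \<open>Laplace expansion along the first row, with each minor written again as
  \<open>mat\<close> of a function so that rewriting can repeat the expansion.\<close>

lemma det_mat_Suc:
  fixes f :: "nat \<times> nat \<Rightarrow> 'a :: comm_ring_1"
  shows "det (mat (Suc n) (Suc n) f) =
    (\<Sum>j<Suc n. f (0, j) * ((-1) ^ j * det (mat n n (\<lambda>(i, k). f (Suc i, if k < j then k else Suc k)))))"
proof -
  have "det (mat (Suc n) (Suc n) f) =
      (\<Sum>j<Suc n. mat (Suc n) (Suc n) f $$ (0, j) * cofactor (mat (Suc n) (Suc n) f) 0 j)"
    by (rule laplace_expansion_row) auto
  also have "\<dots> = (\<Sum>j<Suc n. f (0, j) * ((-1) ^ j * det (mat n n (\<lambda>(i, k). f (Suc i, if k < j then k else Suc k)))))"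
  proof (intro sum.cong refl)
    fix j assume "j \<in> {..<Suc n}"
    then have "mat_delete (mat (Suc n) (Suc n) f) 0 j = mat n n (\<lambda>(i, k). f (Suc i, if k < j then k else Suc k))"
      by (intro eq_matI) (auto simp: mat_delete_def)
    then show "mat (Suc n) (Suc n) f $$ (0, j) * cofactor (mat (Suc n) (Suc n) f) 0 j =
        f (0, j) * ((-1) ^ j * det (mat n n (\<lambda>(i, k). f (Suc i, if k < j then k else Suc k))))"
      using \<open>j \<in> {..<Suc n}\<close> by (simp add: cofactor_def)
  qed
  finally show ?thesis .
qed

text \<open>
  The classes \<open>C1, C2, C3, {u}, {v}\<close> are numbered from 0 to 4, the diagonal contains the added
  identity, and \<open>e\<close> is 1 if \<open>uv\<close> is an edge and 0 otherwise.
\<close>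

definition quotient_weight :: "nat \<Rightarrow> nat \<Rightarrow> nat \<Rightarrow> nat" where
  "quotient_weight e k l =
     (if k = l \<or> {k, l} \<in> {{0, 1}, {1, 2}, {0, 3}, {2, 4}} then 1 else if {k, l} = {3, 4} then e else 0)"

definition class_size :: "nat \<Rightarrow> nat" where
  "class_size k = (if k < 3 then 5 else 1)"

text \<open>The two factors reflect the symmetry exchanging \<open>C1\<close> with \<open>C3\<close>
  and \<open>u\<close> with \<open>v\<close>: the first is the determinant on antisymmetric vectors,
  the second that on symmetric ones. The proof itself is a full expansion.\<close>

lemma det_quotient:
  fixes y :: "'a :: comm_ring_1"
  shows "det (mat 5 5 (\<lambda>(k, l). (if k = l then y else 0) - of_nat (quotient_weight e k l * class_size l))) =
    ((y - 5) * (y - 1 + of_nat e) - 5) * ((y - 1 - of_nat e) * ((y - 5)\<^sup>2 - 50) - 5 * (y - 5))"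
proof -
  define f :: "nat \<times> nat \<Rightarrow> 'a" where
    "f = (\<lambda>(k, l). (if k = l then y else 0) - of_nat (quotient_weight e k l * class_size l))"
  have five: "5 = Suc (Suc (Suc (Suc (Suc 0))))" by simp
  have det_0: "det (mat 0 0 g) = 1" for g :: "nat \<times> nat \<Rightarrow> 'a" by simp
  have "det (mat 5 5 f) =
    ((y - 5) * (y - 1 + of_nat e) - 5) * ((y - 1 - of_nat e) * ((y - 5)\<^sup>2 - 50) - 5 * (y - 5))"
    unfolding five
    by (simp only: det_mat_Suc det_0 sum.lessThan_Suc lessThan_0 sum.empty case_prod_conv add_0
        mult_1_right power_0 if_False if_True less_Suc_eq less_nat_zero_code simp_thms nat.inject nat.distinct)
      (simp add: f_def quotient_weight_def class_size_def doubleton_eq_iff power2_eq_square algebra_simps)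
  then show ?thesis unfolding f_def .
qed

section \<open>Positive energy from a factored characteristic polynomial\<close>

lemma adjacency_matrix_eq_wrt:
  assumes "finite (pverts G)"
  obtains vs where "distinct vs" "set vs = pverts G" "adjacency_matrix G = adjacency_matrix_wrt vs G"
  using someI_ex[OF finite_distinct_list[OF assms, unfolded conj_commute[of "set _ = _"]]]
  unfolding adjacency_matrix_def by blast

lemma adjacency_matrix_wrt_carrier: "adjacency_matrix_wrt vs G \<in> carrier_mat (length vs) (length vs)"
  by (simp add: adjacency_matrix_wrt_def)

text \<open>The linear factors are distinct because \<open>R\<close> is a set, and \<open>g\<close>
  has no positive zero. Hence the positive eigenvalues are exactly the elements of \<open>R\<close>,
  each a simple root.\<close>

lemma positive_energy_eq:
  assumes fin: "finite (pverts G)" "finite R"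
    and char: "char_poly (adjacency_matrix G) = g * (\<Prod>r\<in>R. [:- r, 1:])"
    and R: "\<And>r. r \<in> R \<Longrightarrow> 0 < r"
    and g: "\<And>x. 0 < x \<Longrightarrow> poly g x \<noteq> 0"
  shows "positive_energy p G = (\<Sum>r\<in>R. r powr p)"
proof -
  obtain n where A: "adjacency_matrix G \<in> carrier_mat n n"
    using adjacency_matrix_eq_wrt[OF fin(1)] adjacency_matrix_wrt_carrier by metis
  have "{x. eigenvalue (adjacency_matrix G) x \<and> x > 0} = R"
    using R g by (auto simp: eigenvalue_root_char_poly[OF A] char poly_prod fin(2))
  moreover have "order r (char_poly (adjacency_matrix G)) = 1" if r: "r \<in> R" for r
  proof -
    define h where "h = g * (\<Prod>s\<in>R - {r}. [:- s, 1:])"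
    have eq: "char_poly (adjacency_matrix G) = [:- r, 1:] * h"
      unfolding char h_def prod.remove[OF fin(2) r] by (simp add: mult_ac)
    have h: "poly h r \<noteq> 0"
      using g R r fin(2) by (simp add: h_def poly_prod)
    then have "h \<noteq> 0" by auto
    then show ?thesis
      using order_mult[of "[:- r, 1:]" h r] order_0I[OF h] order_power_n_n[of r 1]
      unfolding eq by (simp del: mult_pCons_left)
  qed
  ultimately show ?thesis
    unfolding positive_energy_def by simp
qed

text \<open>By Vieta's formula the third root is \<open>- (r + s + b)\<close>.\<close>

lemma cubic_factor:
  fixes a b c d r s :: real
  assumes "poly [:d, c, b, 1:] r = 0" "poly [:d, c, b, 1:] s = 0" "r \<noteq> s"
  shows "[:d, c, b, 1:] = [:r + s + b, 1:] * ([:- r, 1:] * [:- s, 1:])"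
proof -
  have r: "d + r * (c + r * (b + r)) = 0" and s: "d + s * (c + s * (b + s)) = 0"
    using assms by simp_all
  \<comment> \<open>The difference of the two root equations is a multiple of \<open>r - s\<close>.
    Cancelling that factor determines \<open>c\<close>, and the equation at \<open>r\<close> then
    determines \<open>d\<close>.\<close>
  then have "(r - s) * (c + b * (r + s) + r\<^sup>2 + r * s + s\<^sup>2) = 0"
    by (simp add: algebra_simps power2_eq_square)
  then have c: "c = - (b * (r + s) + r\<^sup>2 + r * s + s\<^sup>2)"
    using assms(3) by simp
  then have "d = r * s * (r + s + b)"
    using r unfolding c by (simp add: algebra_simps power2_eq_square)
  with c show ?thesis
    by (simp add: algebra_simps power2_eq_square)
qed

lemma quadratic_factor:
  fixes b c r :: real
  assumes "poly [:c, b, 1:] r = 0"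
  shows "[:c, b, 1:] = [:r + b, 1:] * [:- r, 1:]"
  using assms by (simp add: algebra_simps)

text \<open>The parameter \<open>e\<close> lets one determinant serve both graphs. For
  \<open>e = 0\<close> the quadratic factor still contains \<open>x + 1\<close>, which supplies the
  thirteenth power.\<close>

lemma char_poly_clique_path:
  fixes G :: "'a pair_pre_digraph"
  assumes verts: "pverts G = C1 \<union> C2 \<union> C3 \<union> {u, v}"
    and card: "card C1 = 5" "card C2 = 5" "card C3 = 5"
    and disjoint: "C1 \<inter> C2 = {}" "C1 \<inter> C3 = {}" "C2 \<inter> C3 = {}"
      "u \<notin> C1 \<union> C2 \<union> C3" "v \<notin> C1 \<union> C2 \<union> C3" "u \<noteq> v"
    and adj: "\<And>x y. x \<in> pverts G \<Longrightarrow> y \<in> pverts G \<Longrightarrow> of_bool ((x, y) \<in> parcs G) + of_bool (x = y) =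
      quotient_weight e (if x \<in> C1 then 0 else if x \<in> C2 then 1 else if x \<in> C3 then 2 else if x = u then 3 else 4)
       (if y \<in> C1 then 0 else if y \<in> C2 then 1 else if y \<in> C3 then 2 else if y = u then 3 else 4)"
  shows "e = 0 \<Longrightarrow> char_poly (adjacency_matrix G) = [:1, 1:] ^ 12 * ([:-5, -4, 1:] * [:20, -39, -8, 1:])"
    and "e = 1 \<Longrightarrow> char_poly (adjacency_matrix G) = [:1, 1:] ^ 12 * ([:-9, -3, 1:] * [:54, -31, -9, 1:])"
proof -
  define \<kappa> :: "'a \<Rightarrow> nat" where "\<kappa> x = (if x \<in> C1 then 0 else if x \<in> C2 then 1 else if x \<in> C3 then 2 else if x = u then 3 else 4)" for x
  have fin: "finite C1" "finite C2" "finite C3"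
    using card by (auto intro: card_ge_0_finite)
  obtain vs where vs: "distinct vs" "set vs = pverts G" "adjacency_matrix G = adjacency_matrix_wrt vs G"
    using adjacency_matrix_eq_wrt[of G] fin verts by auto
  have "length vs = card (C1 \<union> C2 \<union> C3 \<union> {u, v})"
    using vs verts distinct_card by metis
  also have "\<dots> = 17"
    using disjoint fin card by (simp add: card_Un_disjoint Int_Un_distrib2)
  finally have len: "length vs = 17" .
  have size: "card {x \<in> set vs. \<kappa> x = k} = class_size k" if "k < 5" for k
  proof -
    have classes: "{x \<in> set vs. \<kappa> x = 0} = C1" "{x \<in> set vs. \<kappa> x = 1} = C2"
      "{x \<in> set vs. \<kappa> x = 2} = C3" "{x \<in> set vs. \<kappa> x = 3} = {u}"
      "{x \<in> set vs. \<kappa> x = 4} = {v}"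
      using disjoint unfolding vs(2) verts \<kappa>_def by (auto split: if_splits)
    consider "k = 0" | "k = 1" | "k = 2" | "k = 3" | "k = 4"
      using \<open>k < 5\<close> by linarith
    then show ?thesis
      by cases (simp_all add: classes card class_size_def del: One_nat_def)
  qed
  \<comment> \<open>With 17 vertices and 5 classes, cancelling the fifth power leaves the exponent
    12.\<close>
  have "[:1, 1:] ^ 5 * char_poly (adjacency_matrix G) = [:1, 1:] ^ 5 * ([:1, 1:] ^ 12 *
      det (mat 5 5 (\<lambda>(k, l). (if k = l then [:1, 1:] else 0) - of_nat (quotient_weight e k l * class_size l))))"
    unfolding mult.assoc[symmetric] power_add[symmetric] vs(3)
    using char_poly_blowup[of vs \<kappa> 5 class_size G "quotient_weight e"] adj size vs(1,2) len
    by (simp add: \<kappa>_def)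
  then have "char_poly (adjacency_matrix G) = [:1, 1:] ^ 12 *
      det (mat 5 5 (\<lambda>(k, l). (if k = l then [:1, 1:] else 0) - of_nat (quotient_weight e k l * class_size l)))"
    by (subst (asm) mult_left_cancel) simp_all
  moreover have "[:1, 1:] - 5 = [:-4, 1 :: real:]" "[:1, 1:] - 1 + of_nat e = [:real e, 1:]"
    "[:1, 1:] - 1 - of_nat e = [:- real e, 1:]"
    by (simp_all add: numeral_poly of_nat_poly one_pCons)
  ultimately have char: "char_poly (adjacency_matrix G) = [:1, 1:] ^ 12 *
      (([:-4, 1:] * [:real e, 1:] - 5) * ([:- real e, 1:] * ([:-4, 1:]\<^sup>2 - 50) - 5 * [:-4, 1:]))"
    unfolding det_quotient by simp
  show "e = 0 \<Longrightarrow> char_poly (adjacency_matrix G) = [:1, 1:] ^ 12 * ([:-5, -4, 1:] * [:20, -39, -8, 1:])"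
    unfolding char by (intro arg_cong2[of _ _ _ _ "(*)"] refl) (simp_all add: numeral_poly power2_eq_square)
  show "e = 1 \<Longrightarrow> char_poly (adjacency_matrix G) = [:1, 1:] ^ 12 * ([:-9, -3, 1:] * [:54, -31, -9, 1:])"
    unfolding char by (intro arg_cong2[of _ _ _ _ "(*)"] refl) (simp_all add: numeral_poly power2_eq_square)
qed

section \<open>Exponential sums\<close>

text \<open>Multiplication by \<open>exp (- m * z)\<close> preserves the zeros; differentiation then
  multiplies each coefficient by \<open>l i - m\<close>. A term with \<open>l i = m\<close>
  disappears, and terms with \<open>l i < m\<close> change sign.\<close>

lemma exp_sum_rolle:
  fixes c l :: "'i \<Rightarrow> real"
  assumes "s < t" "(\<Sum>i\<in>I. c i * exp (l i * s)) = 0" "(\<Sum>i\<in>I. c i * exp (l i * t)) = 0"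
  shows "\<exists>z>s. z < t \<and> (\<Sum>i\<in>I. c i * (l i - m) * exp (l i * z)) = 0"
proof -
  define F where "F = (\<lambda>z. \<Sum>i\<in>I. c i * exp ((l i - m) * z))"
  have factor: "(\<Sum>i\<in>I. d i * exp ((l i - m) * z)) = exp (- m * z) * (\<Sum>i\<in>I. d i * exp (l i * z))"
    for d :: "'i \<Rightarrow> real" and z
    by (simp add: sum_distrib_left algebra_simps flip: exp_add)
  have deriv: "(F has_real_derivative (\<Sum>i\<in>I. c i * (l i - m) * exp ((l i - m) * z))) (at z)" for z
    unfolding F_def by (auto intro!: derivative_eq_intros sum.cong)
  have "F s = F t"
    unfolding F_def factor assms by simp
  then obtain z where z: "s < z" "z < t" "(F has_real_derivative 0) (at z)"
    using Rolle[OF assms(1), of F] deriv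
    by (meson DERIV_continuous continuous_at_imp_continuous_on real_differentiable_def)
  then have "(\<Sum>i\<in>I. c i * (l i - m) * exp ((l i - m) * z)) = 0"
    using deriv DERIV_unique by blast
  then show ?thesis
    using z unfolding factor by auto
qed

text \<open>Three rounds of Rolle reduce four zeros to three, two and one. Placing the shifts at the
  sign changes of the coefficients makes the final coefficients nonnegative, so that the last sum
  cannot vanish.\<close>

lemma exp_sum_no_four_zeros:
  fixes c l :: "'i \<Rightarrow> real"
  assumes "finite I"
    and nonneg: "\<And>i. i \<in> I \<Longrightarrow> 0 \<le> c i * (l i - m1) * (l i - m2) * (l i - m3)"
    and pos: "\<exists>i\<in>I. 0 < c i * (l i - m1) * (l i - m2) * (l i - m3)"
    and order: "q < r" "r < s" "s < t"
    and zeros: "\<And>z. z \<in> {q, r, s, t} \<Longrightarrow> (\<Sum>i\<in>I. c i * exp (l i * z)) = 0"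
  shows False
proof -
  let ?c1 = "\<lambda>i. c i * (l i - m1)"
  let ?c2 = "\<lambda>i. ?c1 i * (l i - m2)"
  let ?c3 = "\<lambda>i. ?c2 i * (l i - m3)"
  obtain a1 a2 a3 where a: "q < a1" "a1 < r" "r < a2" "a2 < s" "s < a3" "a3 < t"
    "(\<Sum>i\<in>I. ?c1 i * exp (l i * a1)) = 0" "(\<Sum>i\<in>I. ?c1 i * exp (l i * a2)) = 0"
    "(\<Sum>i\<in>I. ?c1 i * exp (l i * a3)) = 0"
    using exp_sum_rolle[of q r c l I m1] exp_sum_rolle[of r s c l I m1] exp_sum_rolle[of s t c l I m1]
      order zeros by auto
  obtain b1 b2 where b: "a1 < b1" "b1 < a2" "a2 < b2" "b2 < a3"
    "(\<Sum>i\<in>I. ?c2 i * exp (l i * b1)) = 0" "(\<Sum>i\<in>I. ?c2 i * exp (l i * b2)) = 0"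
    using exp_sum_rolle[of a1 a2 ?c1 l I m2] exp_sum_rolle[of a2 a3 ?c1 l I m2] a by auto
  obtain z where "(\<Sum>i\<in>I. ?c3 i * exp (l i * z)) = 0"
    using exp_sum_rolle[of b1 b2 ?c2 l I m3] b by auto
  moreover have "0 < (\<Sum>i\<in>I. ?c3 i * exp (l i * z))"
  proof -
    obtain i where "i \<in> I" "0 < ?c3 i" using pos by blast
    then show ?thesis
      using assms(1) nonneg by (intro sum_pos2[of I i]) auto
  qed
  ultimately show False by simp
qed

section \<open>Signs of a function with at most three zeros\<close>

lemma ivt_zero:
  fixes f :: "real \<Rightarrow> real"
  assumes "continuous_on UNIV f" "f x < 0" "0 < f y"
  shows "\<exists>z. min x y < z \<and> z < max x y \<and> f z = 0"
proof -
  have "continuous_on {min x y..max x y} f"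
    using assms(1) continuous_on_subset by blast
  then obtain z where "min x y \<le> z" "z \<le> max x y" "f z = 0"
    using IVT'[of f x 0 y] IVT2'[of f x 0 y] assms(2,3)
    by (cases "x \<le> y") (force simp: min_def max_def)+
  moreover from this have "z \<noteq> x" "z \<noteq> y"
    using assms(2,3) by auto
  ultimately show ?thesis
    by (intro exI[of _ z]) (auto simp: min_def max_def split: if_splits)
qed

text \<open>The zero at the origin uses up one of the three, so the zeros trapped between the test
  points are the only positive ones. A wrong sign at \<open>p\<close> would produce another, between
  \<open>p\<close> and a suitable test point.\<close>

lemma negative_between_zeros:
  fixes f :: "real \<Rightarrow> real"
  assumes cont: "continuous_on UNIV f" and f0: "f 0 = 0"
    and no_four: "\<And>q r s t. q < r \<Longrightarrow> r < s \<Longrightarrow> s < t \<Longrightarrow> \<exists>z\<in>{q, r, s, t}. f z \<noteq> 0"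
    and order: "0 < a" "a < a'" "a' < b" "b < b'"
    and signs: "0 < f a" "f a' < 0" "f b < 0" "0 < f b'"
  shows "\<exists>\<alpha>\<in>{a<..<a'}. \<exists>\<beta>\<in>{b<..<b'}. \<forall>p>0. f p < 0 \<longleftrightarrow> \<alpha> < p \<and> p < \<beta>"
proof -
  obtain \<alpha> where \<alpha>: "a < \<alpha>" "\<alpha> < a'" "f \<alpha> = 0"
    using ivt_zero[OF cont signs(2,1)] order by auto
  obtain \<beta> where \<beta>: "b < \<beta>" "\<beta> < b'" "f \<beta> = 0"
    using ivt_zero[OF cont signs(3,4)] order by auto
  have zero: "z = \<alpha> \<or> z = \<beta>" if "0 < z" "f z = 0" for z
  proof (rule ccontr)
    assume "\<not> (z = \<alpha> \<or> z = \<beta>)"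
    then consider "z < \<alpha>" | "\<alpha> < z" "z < \<beta>" | "\<beta> < z" by linarith
    then show False
      using no_four[of 0 z \<alpha> \<beta>] no_four[of 0 \<alpha> z \<beta>] no_four[of 0 \<alpha> \<beta> z] that f0 \<alpha> \<beta> order
      by cases auto
  qed
  have "f p < 0 \<longleftrightarrow> \<alpha> < p \<and> p < \<beta>" if p: "0 < p" for p
  proof
    assume neg: "f p < 0"
    show "\<alpha> < p \<and> p < \<beta>"
    proof (rule ccontr)
      assume "\<not> (\<alpha> < p \<and> p < \<beta>)"
      moreover have "p \<noteq> \<alpha>" "p \<noteq> \<beta>" using neg \<alpha>(3) \<beta>(3) by auto
      ultimately consider "p < \<alpha>" | "p > \<beta>" by linarith
      then show False
      proof cases
        case 1
        \<comment> \<open>Both \<open>p\<close> and \<open>a\<close> lie strictly between 0 and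
          \<alpha>, so a zero between them is neither \<alpha> nor \<beta>.\<close>
        obtain z where "min p a < z" "z < max p a" "f z = 0"
          using ivt_zero[OF cont neg signs(1)] by blast
        with 1 show False
          using zero[of z] p \<alpha> \<beta> order by linarith
      next
        case 2
        obtain z where "min p b' < z" "z < max p b'" "f z = 0"
          using ivt_zero[OF cont neg signs(4)] by blast
        with 2 show False
          using zero[of z] p \<alpha> \<beta> order by linarith
      qed
    qed
  next
    assume between: "\<alpha> < p \<and> p < \<beta>"
    show "f p < 0"
    proof (rule ccontr)
      assume "\<not> f p < 0"
      then have "0 < f p"
        using zero[OF p] between by fastforce
      then obtain z where "min a' p < z" "z < max a' p" "f z = 0"
        using ivt_zero[OF cont signs(2)] by blast
      then show False
        using zero[of z] p between \<alpha> \<beta> order by linarith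
    qed
  qed
  then show ?thesis
    using \<alpha> \<beta> by (intro bexI[of _ \<alpha>] bexI[of _ \<beta>]) auto
qed

definition energy_gap :: "real \<Rightarrow> real \<Rightarrow> real \<Rightarrow> real \<Rightarrow> real \<Rightarrow> real \<Rightarrow> real \<Rightarrow> real" where
  "energy_gap x1 x2 x3 y1 y2 y3 p =
     x1 powr p + x2 powr p + x3 powr p - y1 powr p - y2 powr p - y3 powr p"

text \<open>In decreasing order the bases \<open>x1, y1, y2, x2, x3, y3\<close> carry the signs
  \<open>+ - - + + -\<close>. The shifts \<open>ln y1\<close>, \<open>ln y2\<close>,
  \<open>ln x3\<close> delete three terms; those of \<open>x1\<close>, \<open>x2\<close>,
  \<open>y3\<close> receive zero, two and three negative factors and all become positive.\<close>

lemma energy_gap_no_four_zeros: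
  fixes x1 x2 x3 y1 y2 y3 :: real
  assumes pos: "0 < y3" and bases: "y3 < x3" "x3 < x2" "x2 < y2" "y2 < y1" "y1 < x1"
    and order: "q < r" "r < s" "s < t"
  shows "\<exists>p\<in>{q, r, s, t}. energy_gap x1 x2 x3 y1 y2 y3 p \<noteq> 0"
proof (rule ccontr)
  assume contra: "\<not> ?thesis"
  define c :: "nat \<Rightarrow> real" where "c i = [1, 1, 1, -1, -1, -1] ! i" for i
  define l :: "nat \<Rightarrow> real" where "l i = [ln x1, ln x2, ln x3, ln y1, ln y2, ln y3] ! i" for i
  have expand: "(\<Sum>i<6. h i) = h 0 + h 1 + h 2 + h 3 + h 4 + h 5" for h :: "nat \<Rightarrow> real"
    by (simp add: eval_nat_numeral)
  have "(\<Sum>i<6. c i * exp (l i * p)) = energy_gap x1 x2 x3 y1 y2 y3 p" for p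
    unfolding expand energy_gap_def using assms by (simp add: c_def l_def powr_def mult.commute)
  then have zeros: "(\<Sum>i<6. c i * exp (l i * p)) = 0" if "p \<in> {q, r, s, t}" for p
    using contra that by auto
  have ln: "ln y3 < ln x3" "ln x3 < ln x2" "ln x2 < ln y2" "ln y2 < ln y1" "ln y1 < ln x1"
    using assms by simp_all
  have weights: "0 < c 0 * (l 0 - ln y1) * (l 0 - ln y2) * (l 0 - ln x3)"
    "0 < c 1 * (l 1 - ln y1) * (l 1 - ln y2) * (l 1 - ln x3)"
    "0 < c 5 * (l 5 - ln y1) * (l 5 - ln y2) * (l 5 - ln x3)"
    using ln by (simp_all add: c_def l_def zero_less_mult_iff mult_less_0_iff)
  have nonneg: "0 \<le> c i * (l i - ln y1) * (l i - ln y2) * (l i - ln x3)" if "i \<in> {..<6}" for i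
  proof -
    consider "i = 0" | "i = 1" | "i = 2" | "i = 3" | "i = 4" | "i = 5"
      using \<open>i \<in> {..<6}\<close> by (auto simp: less_Suc_eq eval_nat_numeral)
    then show ?thesis
      using weights by cases (simp_all add: l_def)
  qed
  show False
  proof (rule exp_sum_no_four_zeros[OF _ nonneg _ order zeros])
    show "\<exists>i\<in>{..<6}. 0 < c i * (l i - ln y1) * (l i - ln y2) * (l i - ln x3)"
      using weights(1) by (intro bexI[of _ 0]) simp_all
  qed simp_all
qed

section \<open>Certified bounds for real powers\<close>

text \<open>
  Fixed-point arithmetic: \<open>exp_lower x\<close> and \<open>exp_upper x\<close> bound \<open>2 ^ 96 * exp (x / 2 ^ 90)\<close>. The
  exponential is taken at \<open>x / 2 ^ 96\<close>, the 64th part of the argument, by a Taylor polynomial of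
  degree 16, and the result is squared six times. The Horner scheme runs with
  \<open>c = fact 16 / fact k\<close>, so that the only division is the final one by \<open>fact 16\<close>.
  The initial value \<open>2 ^ 97\<close> of the upper bound accounts for the Lagrange remainder.
\<close>

primrec taylor_lower :: "nat \<Rightarrow> nat \<Rightarrow> nat \<Rightarrow> nat \<Rightarrow> nat" where
  "taylor_lower x 0 c g = g"
| "taylor_lower x (Suc k) c g =
     taylor_lower x k (Suc k * c) (2 ^ 96 * (Suc k * c) + drop_bit 96 (x * g))"

primrec taylor_upper :: "nat \<Rightarrow> nat \<Rightarrow> nat \<Rightarrow> nat \<Rightarrow> nat" where
  "taylor_upper x 0 c g = g"
| "taylor_upper x (Suc k) c g =
     taylor_upper x k (Suc k * c) (2 ^ 96 * (Suc k * c) + drop_bit 96 (x * g) + 1)"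

primrec squares_lower :: "nat \<Rightarrow> nat \<Rightarrow> nat" where
  "squares_lower 0 h = h"
| "squares_lower (Suc k) h = squares_lower k (drop_bit 96 (h * h))"

primrec squares_upper :: "nat \<Rightarrow> nat \<Rightarrow> nat" where
  "squares_upper 0 h = h"
| "squares_upper (Suc k) h = squares_upper k (drop_bit 96 (h * h) + 1)"

definition exp_lower :: "nat \<Rightarrow> nat" where
  "exp_lower x = squares_lower 6 (taylor_lower x 16 1 (2 ^ 96) div fact 16)"

definition exp_upper :: "nat \<Rightarrow> nat" where
  "exp_upper x = squares_upper 6 (taylor_upper x 16 1 (2 ^ 97) div fact 16 + 1)"

text \<open>The primitive recursive equations match \<open>0\<close> and \<open>Suc\<close>; these
  versions match numerals, so that the simplifier can run the computation.\<close>

lemma recursion_numeral: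
  "taylor_lower x (numeral k) c g =
     taylor_lower x (pred_numeral k) (numeral k * c) (2 ^ 96 * (numeral k * c) + drop_bit 96 (x * g))"
  "taylor_upper x (numeral k) c g =
     taylor_upper x (pred_numeral k) (numeral k * c) (2 ^ 96 * (numeral k * c) + drop_bit 96 (x * g) + 1)"
  "squares_lower (numeral k) h = squares_lower (pred_numeral k) (drop_bit 96 (h * h))"
  "squares_upper (numeral k) h = squares_upper (pred_numeral k) (drop_bit 96 (h * h) + 1)"
  by (simp_all only: numeral_eq_Suc[of k] taylor_lower.simps taylor_upper.simps
      squares_lower.simps squares_upper.simps)

lemmas exp_eval = exp_lower_def exp_upper_def recursion_numeral fact_numeral

lemma real_div_bounds:
  fixes m n :: nat
  assumes "n > 0"
  shows "real (m div n) \<le> real m / real n" "real m / real n \<le> real (m div n) + 1"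
proof -
  have "real n * real (m div n) + real (m mod n) = real m"
    by (metis mult_div_mod_eq of_nat_add of_nat_mult)
  moreover have "real (m mod n) < real n" "0 \<le> real (m mod n)"
    using assms by simp_all
  ultimately have "real n * real (m div n) \<le> real m" "real m \<le> real n * (real (m div n) + 1)"
    unfolding distrib_left by linarith+
  then show "real (m div n) \<le> real m / real n" "real m / real n \<le> real (m div n) + 1"
    using assms by (simp_all add: pos_le_divide_eq pos_divide_le_eq mult.commute)
qed

lemma real_drop_bit_bounds:
  "real (drop_bit n m) \<le> real m / 2 ^ n" "real m / 2 ^ n \<le> real (drop_bit n m) + 1"
  using real_div_bounds[of "2 ^ n" m] by (simp_all add: drop_bit_eq_div)

text \<open>Invariant of the Horner scheme: a step without rounding preserves this expression, with
  \<open>b\<close> as the fixed-point scale and \<open>X\<close> as the argument.\<close>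

lemma taylor_step:
  fixes X :: real
  shows "b * c * fact (Suc k) * (\<Sum>i<Suc k. X ^ i / fact i) + X ^ Suc k * g =
    b * (real (Suc k) * c) * fact k * (\<Sum>i<k. X ^ i / fact i) + X ^ k * (b * (real (Suc k) * c) + X * g)"
  by (simp add: field_simps)

text \<open>Each \<open>drop_bit\<close> rounds down and its error is multiplied by a nonnegative
  power, so the errors all point in one direction.\<close>

lemma taylor_lower_le:
  "real (taylor_lower x k c g) \<le>
     2 ^ 96 * real c * fact k * (\<Sum>i<k. (real x / 2 ^ 96) ^ i / fact i) + (real x / 2 ^ 96) ^ k * real g"
proof (induction k arbitrary: c g)
  case (Suc k)
  have "real (drop_bit 96 (x * g)) \<le> real x / 2 ^ 96 * real g"
    using real_drop_bit_bounds(1)[of 96 "x * g"] by simp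
  then have "real (2 ^ 96 * (Suc k * c) + drop_bit 96 (x * g)) \<le>
      2 ^ 96 * (real (Suc k) * real c) + real x / 2 ^ 96 * real g"
    unfolding of_nat_add of_nat_mult of_nat_power of_nat_numeral by linarith
  then show ?case
    unfolding taylor_lower.simps taylor_step
    by (intro order.trans[OF Suc.IH]) (simp only: of_nat_mult, intro add_left_mono mult_left_mono, simp_all)
qed simp

text \<open>The \<open>1\<close> added after each \<open>drop_bit\<close> outweighs the
  rounding.\<close>

lemma taylor_upper_ge:
  "real (taylor_upper x k c g) \<ge>
     2 ^ 96 * real c * fact k * (\<Sum>i<k. (real x / 2 ^ 96) ^ i / fact i) + (real x / 2 ^ 96) ^ k * real g"
proof (induction k arbitrary: c g)
  case (Suc k)
  have "real x / 2 ^ 96 * real g \<le> real (drop_bit 96 (x * g)) + 1"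
    using real_drop_bit_bounds(2)[of "x * g" 96] by simp
  then have "2 ^ 96 * (real (Suc k) * real c) + real x / 2 ^ 96 * real g \<le>
      real (2 ^ 96 * (Suc k * c) + drop_bit 96 (x * g) + 1)"
    unfolding of_nat_add of_nat_mult of_nat_power of_nat_numeral of_nat_1 by linarith
  then show ?case
    unfolding taylor_upper.simps taylor_step
    by (intro order.trans[OF _ Suc.IH]) (simp only: of_nat_mult, intro add_left_mono mult_left_mono, simp_all)
qed simp

lemma squares_lower_le:
  assumes "real h / 2 ^ 96 \<le> y"
  shows "real (squares_lower k h) / 2 ^ 96 \<le> y ^ 2 ^ k"
  using assms
proof (induction k arbitrary: h y)
  case (Suc k)
  have "real (drop_bit 96 (h * h)) / 2 ^ 96 \<le> (real h / 2 ^ 96) * (real h / 2 ^ 96)"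
    using real_drop_bit_bounds(1)[of 96 "h * h"] by simp
  also have "\<dots> \<le> y\<^sup>2"
    unfolding power2_eq_square using Suc.prems by (intro mult_mono) (auto intro: order.trans[rotated])
  finally show ?case
    using Suc.IH by (simp add: power_mult)
qed simp

lemma squares_upper_ge:
  assumes "real h / 2 ^ 96 \<ge> y" "y \<ge> 0"
  shows "real (squares_upper k h) / 2 ^ 96 \<ge> y ^ 2 ^ k"
  using assms
proof (induction k arbitrary: h y)
  case (Suc k)
  have "y\<^sup>2 \<le> (real h / 2 ^ 96) * (real h / 2 ^ 96)"
    unfolding power2_eq_square using Suc.prems by (intro mult_mono) auto
  also have "\<dots> \<le> real (drop_bit 96 (h * h) + 1) / 2 ^ 96"
    using real_drop_bit_bounds(2)[of "h * h" 96] by simp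
  finally show ?case
    using Suc.IH[of "y\<^sup>2"] by (simp add: power_mult)
qed simp

lemma exp_eq_power: "exp (real x / 2 ^ 90) = exp (real x / 2 ^ 96) ^ 2 ^ 6"
  by (simp flip: exp_of_nat_mult)

lemma exp_lower_le: "real (exp_lower x) \<le> 2 ^ 96 * exp (real x / 2 ^ 90)"
proof -
  define X where "X = real x / 2 ^ 96"
  have X: "0 \<le> X" unfolding X_def by simp
  have "real (taylor_lower x 16 1 (2 ^ 96)) \<le> 2 ^ 96 * fact 16 * (\<Sum>i<16. X ^ i / fact i) + X ^ 16 * 2 ^ 96"
    using taylor_lower_le[of x 16 1 "2 ^ 96"] unfolding X_def by simp
  \<comment> \<open>The initial value \<open>2 ^ 96\<close> contributes exactly the term of degree
    16. The remainder after it is nonnegative because \<open>X\<close> is.\<close>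
  also have "\<dots> = 2 ^ 96 * fact 16 * (\<Sum>i<Suc 16. X ^ i / fact i)"
    unfolding sum.lessThan_Suc ring_distribs by simp
  also have "\<dots> \<le> 2 ^ 96 * fact 16 * exp X"
  proof -
    obtain t where "exp X = (\<Sum>i<Suc 16. X ^ i / fact i) + exp t / fact (Suc 16) * X ^ Suc 16"
      using Maclaurin_exp_le[of X "Suc 16"] by blast
    then show ?thesis
      using X by simp
  qed
  finally have "real (taylor_lower x 16 1 (2 ^ 96)) / fact 16 \<le> 2 ^ 96 * exp X"
    by (simp add: pos_divide_le_eq mult_ac del: fact_numeral)
  then have "real (taylor_lower x 16 1 (2 ^ 96) div fact 16) \<le> 2 ^ 96 * exp X"
    using real_div_bounds(1)[of "fact 16" "taylor_lower x 16 1 (2 ^ 96)"]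
    by (simp del: fact_numeral)
  then have "real (taylor_lower x 16 1 (2 ^ 96) div fact 16) / 2 ^ 96 \<le> exp X"
    by (simp add: pos_divide_le_eq mult_ac del: fact_numeral)
  from squares_lower_le[OF this, of 6] show ?thesis
    by (simp only: exp_lower_def exp_eq_power X_def) (simp add: field_simps)
qed

lemma exp_upper_ge:
  assumes "x \<le> 2 ^ 95"
  shows "2 ^ 96 * exp (real x / 2 ^ 90) \<le> real (exp_upper x)"
proof -
  define X where "X = real x / 2 ^ 96"
  have "real x \<le> real (2 ^ 95)"
    using assms by (simp only: of_nat_le_iff)
  then have X: "0 \<le> X" "X \<le> 1 / 2" unfolding X_def by (simp_all add: field_simps)
  \<comment> \<open>Here the remainder takes the place of the term of degree 16. Since
    \<open>X \<le> 1 / 2\<close>, its factor \<open>exp t\<close> is at most 2, which the initial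
    value \<open>2 ^ 97\<close> covers.\<close>
  obtain t where t: "\<bar>t\<bar> \<le> \<bar>X\<bar>" "exp X = (\<Sum>i<16. X ^ i / fact i) + exp t / fact 16 * X ^ 16"
    using Maclaurin_exp_le[of X 16] by blast
  have "exp t \<le> exp (1 / 2)" using t X by simp
  also have "\<dots> \<le> 2" using exp_bound_half[of "1 / 2 :: real"] by simp
  finally have "exp t \<le> 2" .
  then have "exp t / fact 16 * X ^ 16 \<le> 2 / fact 16 * X ^ 16"
    using X by (intro mult_right_mono divide_right_mono) auto
  then have "2 ^ 96 * fact 16 * exp X \<le> 2 ^ 96 * fact 16 * ((\<Sum>i<16. X ^ i / fact i) + 2 / fact 16 * X ^ 16)"
    unfolding t(2) by (intro mult_left_mono) simp_all
  also have "\<dots> = 2 ^ 96 * fact 16 * (\<Sum>i<16. X ^ i / fact i) + X ^ 16 * 2 ^ 97"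
    by (simp add: algebra_simps del: fact_numeral)
  also have "\<dots> \<le> real (taylor_upper x 16 1 (2 ^ 97))"
    using taylor_upper_ge[of 1 16 x "2 ^ 97"] unfolding X_def by simp
  finally have "2 ^ 96 * exp X \<le> real (taylor_upper x 16 1 (2 ^ 97)) / fact 16"
    by (simp add: pos_le_divide_eq mult_ac del: fact_numeral)
  then have "2 ^ 96 * exp X \<le> real (taylor_upper x 16 1 (2 ^ 97) div fact 16 + 1)"
    using real_div_bounds(2)[of "fact 16" "taylor_upper x 16 1 (2 ^ 97)"]
    by (simp del: fact_numeral)
  then have "exp X \<le> real (taylor_upper x 16 1 (2 ^ 97) div fact 16 + 1) / 2 ^ 96"
    by (simp add: pos_le_divide_eq mult_ac del: fact_numeral)
  from squares_upper_ge[OF this, of 6] show ?thesis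
    by (simp only: exp_upper_def exp_eq_power X_def) (simp add: field_simps)
qed

section \<open>Powers and logarithms in fixed-point arithmetic\<close>

text \<open>From \<open>x powr p = exp (p * ln x)\<close>: \<open>l\<close> bounds the logarithm at
  scale \<open>2 ^ 90\<close>, and \<open>m\<close> is an integer bound for its product with
  \<open>p\<close>.\<close>

lemma powr_lower:
  fixes x p :: real
  assumes "0 < x" "0 \<le> p" "real l \<le> 2 ^ 90 * ln x" "real m \<le> p * real l"
  shows "real (exp_lower m) \<le> 2 ^ 96 * x powr p"
proof -
  have "real m \<le> p * (2 ^ 90 * ln x)"
    using assms(2-4) by (meson mult_left_mono order.trans)
  then have "2 ^ 96 * exp (real m / 2 ^ 90) \<le> 2 ^ 96 * x powr p"
    using assms(1) by (simp add: powr_def field_simps)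
  with exp_lower_le show ?thesis
    by (rule order.trans)
qed

lemma powr_upper:
  fixes x p :: real
  assumes "0 < x" "0 \<le> p" "2 ^ 90 * ln x \<le> real l" "p * real l \<le> real m" "m \<le> 2 ^ 95"
  shows "2 ^ 96 * x powr p \<le> real (exp_upper m)"
proof -
  have "p * (2 ^ 90 * ln x) \<le> real m"
    using assms(2-4) by (meson mult_left_mono order.trans)
  then have "2 ^ 96 * x powr p \<le> 2 ^ 96 * exp (real m / 2 ^ 90)"
    using assms(1) by (simp add: powr_def field_simps)
  then show ?thesis
    using exp_upper_ge[OF assms(5)] by (rule order.trans)
qed

text \<open>A proposed logarithm is verified by exponentiating it, so logarithms are never
  computed.\<close>

lemma ln_lower:
  assumes "0 < x" "real (exp_upper l) \<le> 2 ^ 96 * x" "l \<le> 2 ^ 95"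
  shows "real l \<le> 2 ^ 90 * ln x"
proof -
  have "2 ^ 96 * exp (real l / 2 ^ 90) \<le> 2 ^ 96 * x"
    using exp_upper_ge[OF assms(3)] assms(2) by (rule order.trans)
  then have "real l / 2 ^ 90 \<le> ln x"
    unfolding ln_ge_iff[OF assms(1)] by simp
  then show ?thesis
    by (simp add: field_simps)
qed

lemma ln_upper:
  assumes "0 < x" "2 ^ 96 * x \<le> real (exp_lower l)"
  shows "2 ^ 90 * ln x \<le> real l"
proof -
  have "2 ^ 96 * x \<le> 2 ^ 96 * exp (real l / 2 ^ 90)"
    using assms(2) exp_lower_le by (rule order.trans)
  then have "ln x \<le> ln (exp (real l / 2 ^ 90))"
    using assms(1) by (intro ln_mono) simp_all
  then show ?thesis
    by (simp add: field_simps)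
qed

section \<open>Locating real roots on a grid of step \<open>1 / 2 ^ 96\<close>\<close>

definition near :: "real \<Rightarrow> nat \<Rightarrow> bool" where
  "near x R \<longleftrightarrow> real R \<le> 2 ^ 96 * x \<and> 2 ^ 96 * x \<le> real (R + 1)"

text \<open>The condition on the product covers a sign change in either direction as well as a root
  at a grid point.\<close>

lemma near_root:
  assumes "poly p (real R / 2 ^ 96) * poly p (real (R + 1) / 2 ^ 96) \<le> 0"
  shows "\<exists>x. near x R \<and> poly p x = 0"
proof -
  let ?a = "real R / 2 ^ 96" and ?b = "real (R + 1) / 2 ^ 96"
  have ab: "?a \<le> ?b" by (intro divide_right_mono) simp_all
  have cont: "continuous_on {?a..?b} (poly p)" by (intro continuous_intros)
  have "\<exists>x. ?a \<le> x \<and> x \<le> ?b \<and> poly p x = 0"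
  proof (cases "poly p ?a \<le> 0")
    case True
    show ?thesis
    proof (cases "0 \<le> poly p ?b")
      case True
      then show ?thesis
        using IVT'[OF \<open>poly p ?a \<le> 0\<close> _ ab cont] by blast
    next
      case False
      then have "poly p ?a = 0"
        using assms True by (auto simp: mult_le_0_iff)
      then show ?thesis using ab by blast
    qed
  next
    case False
    then have "poly p ?b \<le> 0"
      using assms by (auto simp: mult_le_0_iff)
    then show ?thesis
      using IVT2'[OF _ _ ab cont, of 0] False by (meson linorder_not_le order_less_imp_le)
  qed
  then obtain x where "?a \<le> x" "x \<le> ?b" "poly p x = 0" by blast
  then show ?thesis
    unfolding near_def pos_divide_le_eq[OF zero_less_power[OF zero_less_numeral]]
      pos_le_divide_eq[OF zero_less_power[OF zero_less_numeral]] by (auto simp: mult.commute)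
qed

lemma near_bounds:
  assumes "near x R"
  shows "real R / 2 ^ 96 \<le> x" "x \<le> (real R + 1) / 2 ^ 96"
  using assms by (simp_all add: near_def field_simps)

lemma near_pos: "near x R \<Longrightarrow> 0 < R \<Longrightarrow> 0 < x"
  unfolding near_def using zero_less_mult_pos[of "2 ^ 96 :: real" x]
  by (metis of_nat_0_less_iff order_less_le_trans zero_less_numeral zero_less_power)

lemma near_ln_lower:
  assumes "near x R" "0 < R" "exp_upper l \<le> R" "l \<le> 2 ^ 95"
  shows "real l \<le> 2 ^ 90 * ln x"
proof (rule ln_lower)
  show "real (exp_upper l) \<le> 2 ^ 96 * x"
    using assms(1,3) unfolding near_def by (meson of_nat_le_iff order.trans)
qed (use assms near_pos in auto)

lemma near_ln_upper:
  assumes "near x R" "0 < R" "R + 1 \<le> exp_lower l"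
  shows "2 ^ 90 * ln x \<le> real l"
proof (rule ln_upper)
  show "2 ^ 96 * x \<le> real (exp_lower l)"
    using assms(1,3) unfolding near_def by (meson of_nat_le_iff order.trans)
qed (use assms near_pos in auto)

lemma near_powr_lower:
  assumes "near x R" "0 < R" "0 \<le> p" "real l \<le> 2 ^ 90 * ln x" "real m \<le> p * real l" "v \<le> exp_lower m"
  shows "real v \<le> 2 ^ 96 * x powr p"
  using powr_lower[OF near_pos[OF assms(1,2)] assms(3-5)] assms(6)
  by (meson of_nat_le_iff order.trans)

lemma near_powr_upper:
  assumes "near x R" "0 < R" "0 \<le> p" "2 ^ 90 * ln x \<le> real l" "p * real l \<le> real m" "exp_upper m \<le> v" "m \<le> 2 ^ 95"
  shows "2 ^ 96 * x powr p \<le> real v"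
  using powr_upper[OF near_pos[OF assms(1,2)] assms(3-5,7)] assms(6)
  by (meson of_nat_le_iff order.trans)

text \<open>
  The bases are written \<open>x1, x2, x3, y1, y2 = 5\<close>, and \<open>z\<close> is the inverse of \<open>y3\<close>, taken to keep all
  logarithms positive. The exponents are the end points of the intervals of length \<open>1 / 10 ^ 19\<close>
  around the decimal values of \<open>\<alpha>\<close> and \<open>\<beta>\<close>.
\<close>

lemma exp_bounds_x1:
  "exp_upper 3003678727716005428712681421 \<le> 896666659861169072589015624884"
  "896666659861169072589015624884 + 1 \<le> exp_lower 3003678727716005428712681424"
  by (simp_all add: exp_eval)

text \<open>Both numerals are proposed values of \<open>2 ^ 90 * ln x1\<close>, confirmed through
  \<open>exp_bounds_x1\<close>. The other bases follow the same pattern.\<close>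

lemma ln_x1:
  assumes "near x1 896666659861169072589015624884"
  shows "real 3003678727716005428712681421 \<le> 2 ^ 90 * ln x1"
    "2 ^ 90 * ln x1 \<le> real 3003678727716005428712681424"
  by (rule near_ln_lower[OF assms _ exp_bounds_x1(1)]
      near_ln_upper[OF assms _ exp_bounds_x1(2)]; simp)+

lemma exp_bounds_x2:
  "exp_upper 1955727525412076278409898041 \<le> 384581579442840071834468499745"
  "384581579442840071834468499745 + 1 \<le> exp_lower 1955727525412076278409898043"
  by (simp_all add: exp_eval)

lemma ln_x2:
  assumes "near x2 384581579442840071834468499745"
  shows "real 1955727525412076278409898041 \<le> 2 ^ 90 * ln x2"
    "2 ^ 90 * ln x2 \<le> real 1955727525412076278409898043"
  by (rule near_ln_lower[OF assms _ exp_bounds_x2(1)]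
      near_ln_upper[OF assms _ exp_bounds_x2(2)]; simp)+

lemma exp_bounds_x3:
  "exp_upper 337963690931868483176564433 \<le> 104098411726227601361457464583"
  "104098411726227601361457464583 + 1 \<le> exp_lower 337963690931868483176564435"
  by (simp_all add: exp_eval)

lemma ln_x3:
  assumes "near x3 104098411726227601361457464583"
  shows "real 337963690931868483176564433 \<le> 2 ^ 90 * ln x3"
    "2 ^ 90 * ln x3 \<le> real 337963690931868483176564435"
  by (rule near_ln_lower[OF assms _ exp_bounds_x3(1)]
      near_ln_upper[OF assms _ exp_bounds_x3(2)]; simp)+

lemma exp_bounds_y1:
  "exp_upper 3001305740018324085478148297 \<le> 894949500035303817866630367303"
  "894949500035303817866630367303 + 1 \<le> exp_lower 3001305740018324085478148299"
  by (simp_all add: exp_eval)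

lemma ln_y1:
  assumes "near y1 894949500035303817866630367303"
  shows "real 3001305740018324085478148297 \<le> 2 ^ 90 * ln y1"
    "2 ^ 90 * ln y1 \<le> real 3001305740018324085478148299"
  by (rule near_ln_lower[OF assms _ exp_bounds_y1(1)]
      near_ln_upper[OF assms _ exp_bounds_y1(2)]; simp)+

lemma exp_bounds_y2:
  "exp_upper 1992387632546050636546694803 \<le> 396140812571321687967719751680"
  "396140812571321687967719751680 + 1 \<le> exp_lower 1992387632546050636546694806"
  by (simp_all add: exp_eval)

lemma ln_y2:
  assumes "near y2 396140812571321687967719751680"
  shows "real 1992387632546050636546694803 \<le> 2 ^ 90 * ln y2"
    "2 ^ 90 * ln y2 \<le> real 1992387632546050636546694806"
  by (rule near_ln_lower[OF assms _ exp_bounds_y2(1)]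
      near_ln_upper[OF assms _ exp_bounds_y2(2)]; simp)+

lemma exp_bounds_z:
  "exp_upper 934292347385435413466522404 \<le> 168518775482488290804508497171"
  "168518775482488290804508497171 + 1 \<le> exp_lower 934292347385435413466522407"
  by (simp_all add: exp_eval)

lemma ln_z:
  assumes "near z 168518775482488290804508497171"
  shows "real 934292347385435413466522404 \<le> 2 ^ 90 * ln z"
    "2 ^ 90 * ln z \<le> real 934292347385435413466522407"
  by (rule near_ln_lower[OF assms _ exp_bounds_z(1)]
      near_ln_upper[OF assms _ exp_bounds_z(2)]; simp)+

section \<open>Powers of the bases at the four test exponents\<close>

lemma powr_x1_below_alpha:
  assumes "near x1 896666659861169072589015624884"
  shows "real 28964668153650128313924245639717 \<le> 2 ^ 96 * x1 powr (243225193382176085775 / 10 ^ 20)"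
proof (rule near_powr_lower[OF assms _ _ ln_x1(1)[OF assms]])
  \<comment> \<open>The argument of \<open>exp_lower\<close> approximates from below the exponent
    times the lower bound in \<open>ln_x1\<close>, and so instantiates \<open>m\<close>.\<close>
  show "28964668153650128313924245639717 \<le> exp_lower 7305703394066540486718246407" by (simp add: exp_eval)
qed simp_all

lemma powr_x2_below_alpha:
  assumes "near x2 384581579442840071834468499745"
  shows "real 3695466505629277978043989048428 \<le> 2 ^ 96 * x2 powr (243225193382176085775 / 10 ^ 20)"
proof (rule near_powr_lower[OF assms _ _ ln_x2(1)[OF assms]])
  show "3695466505629277978043989048428 \<le> exp_lower 4756822055711969478513833401" by (simp add: exp_eval)
qed simp_all

lemma powr_x3_below_alpha:
  assumes "near x3 104098411726227601361457464583"
  shows "real 153906997505888837364639805669 \<le> 2 ^ 96 * x3 powr (243225193382176085775 / 10 ^ 20)"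
proof (rule near_powr_lower[OF assms _ _ ln_x3(1)[OF assms]])
  show "153906997505888837364639805669 \<le> exp_lower 822012840830577022056504964" by (simp add: exp_eval)
qed simp_all

lemma powr_y1_below_alpha:
  assumes "near y1 894949500035303817866630367303"
  shows "2 ^ 96 * y1 powr (243225193382176085775 / 10 ^ 20) \<le> real 28829939189917336356253420285900"
proof (rule near_powr_upper[OF assms _ _ ln_y1(2)[OF assms]])
  show "exp_upper 7299931690149919791612139931 \<le> 28829939189917336356253420285900" by (simp add: exp_eval)
qed simp_all

lemma powr_y2_below_alpha:
  assumes "near y2 396140812571321687967719751680"
  shows "2 ^ 96 * y2 powr (243225193382176085775 / 10 ^ 20) \<le> real 3971464898950830820274069268995"
proof (rule near_powr_upper[OF assms _ _ ln_y2(2)[OF assms]])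
  show "exp_upper 4845988672182691542148113275 \<le> 3971464898950830820274069268995" by (simp add: exp_eval)
qed simp_all

text \<open>The bound runs opposite to those for \<open>y1\<close> and \<open>y2\<close>, since the
  power of \<open>y3\<close> is the inverse of that of \<open>z\<close>.\<close>

lemma powr_z_below_alpha:
  assumes "near z 168518775482488290804508497171"
  shows "real 496701721134111344949259140603 \<le> 2 ^ 96 * z powr (243225193382176085775 / 10 ^ 20)"
proof (rule near_powr_lower[OF assms _ _ ln_z(1)[OF assms]])
  show "496701721134111344949259140603 \<le> exp_lower 2272434368683097661227319723" by (simp add: exp_eval)
qed simp_all

text \<open>Between \<alpha> and \<beta> the energy difference is to be negative, so every bound is
  reversed at this exponent and at the next one.\<close>

lemma powr_x1_above_alpha:
  assumes "near x1 896666659861169072589015624884"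
  shows "2 ^ 96 * x1 powr (243225193382176085785 / 10 ^ 20) \<le> real 28964668153650128320952094944322"
proof (rule near_powr_upper[OF assms _ _ ln_x1(2)[OF assms]])
  show "exp_upper 7305703394066540487018614288 \<le> 28964668153650128320952094944322" by (simp add: exp_eval)
qed simp_all

lemma powr_x2_above_alpha:
  assumes "near x2 384581579442840071834468499745"
  shows "2 ^ 96 * x2 powr (243225193382176085785 / 10 ^ 20) \<le> real 3695466505629277978627807778897"
proof (rule near_powr_upper[OF assms _ _ ln_x2(2)[OF assms]])
  show "exp_upper 4756822055711969478709406159 \<le> 3695466505629277978627807778897" by (simp add: exp_eval)
qed simp_all

lemma powr_x3_above_alpha:
  assumes "near x3 104098411726227601361457464583"
  shows "2 ^ 96 * x3 powr (243225193382176085785 / 10 ^ 20) \<le> real 153906997505888837368841542961"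
proof (rule near_powr_upper[OF assms _ _ ln_x3(2)[OF assms]])
  show "exp_upper 822012840830577022090301338 \<le> 153906997505888837368841542961" by (simp add: exp_eval)
qed simp_all

lemma powr_y1_above_alpha:
  assumes "near y1 894949500035303817866630367303"
  shows "real 28829939189917336363243052823439 \<le> 2 ^ 96 * y1 powr (243225193382176085785 / 10 ^ 20)"
proof (rule near_powr_lower[OF assms _ _ ln_y1(1)[OF assms]])
  show "28829939189917336363243052823439 \<le> exp_lower 7299931690149919791912270499" by (simp add: exp_eval)
qed simp_all

lemma powr_y2_above_alpha:
  assumes "near y2 396140812571321687967719751680"
  shows "real 3971464898950830820913251857347 \<le> 2 ^ 96 * y2 powr (243225193382176085785 / 10 ^ 20)"
proof (rule near_powr_lower[OF assms _ _ ln_y2(1)[OF assms]])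
  show "3971464898950830820913251857347 \<le> exp_lower 4845988672182691542347352030" by (simp add: exp_eval)
qed simp_all

lemma powr_z_above_alpha:
  assumes "near z 168518775482488290804508497171"
  shows "2 ^ 96 * z powr (243225193382176085785 / 10 ^ 20) \<le> real 496701721134111344986745985610"
proof (rule near_powr_upper[OF assms _ _ ln_z(2)[OF assms]])
  show "exp_upper 2272434368683097661320748966 \<le> 496701721134111344986745985610" by (simp add: exp_eval)
qed simp_all

lemma powr_x1_below_beta:
  assumes "near x1 896666659861169072589015624884"
  shows "2 ^ 96 * x1 powr (304083599541916779065 / 10 ^ 20) \<le> real 126813324309855516496963413655576"
proof (rule near_powr_upper[OF assms _ _ ln_x1(2)[OF assms]])
  show "exp_upper 9133694393913678821364049104 \<le> 126813324309855516496963413655576" by (simp add: exp_eval)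
qed simp_all

lemma powr_x2_below_beta:
  assumes "near x2 384581579442840071834468499745"
  shows "2 ^ 96 * x2 powr (304083599541916779065 / 10 ^ 20) \<le> real 9665497400059960452896842898040"
proof (rule near_powr_upper[OF assms _ _ ln_x2(2)[OF assms]])
  show "exp_upper 5947046656505096741014831078 \<le> 9665497400059960452896842898040" by (simp add: exp_eval)
qed simp_all

lemma powr_x3_below_beta:
  assumes "near x3 104098411726227601361457464583"
  shows "2 ^ 96 * x3 powr (304083599541916779065 / 10 ^ 20) \<le> real 181725069126606824657431111523"
proof (rule near_powr_upper[OF assms _ _ ln_x3(2)[OF assms]])
  show "exp_upper 1027692156530344269897179827 \<le> 181725069126606824657431111523" by (simp add: exp_eval)
qed simp_all

lemma powr_y1_below_beta:
  assumes "near y1 894949500035303817866630367303"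
  shows "real 126076288412840361459829299490181 \<le> 2 ^ 96 * y1 powr (304083599541916779065 / 10 ^ 20)"
proof (rule near_powr_lower[OF assms _ _ ln_y1(1)[OF assms]])
  show "126076288412840361459829299490181 \<le> exp_lower 9126478527505882534806054324" by (simp add: exp_eval)
qed simp_all

lemma powr_y2_below_beta:
  assumes "near y2 396140812571321687967719751680"
  shows "real 10576274951504690100914340533103 \<le> 2 ^ 96 * y2 powr (304083599541916779065 / 10 ^ 20)"
proof (rule near_powr_lower[OF assms _ _ ln_y2(1)[OF assms]])
  show "10576274951504690100914340533103 \<le> exp_lower 6058524029874008992756564134" by (simp add: exp_eval)
qed simp_all

lemma powr_z_below_beta:
  assumes "near z 168518775482488290804508497171"
  shows "2 ^ 96 * z powr (304083599541916779065 / 10 ^ 20) \<le> real 786267778087508773053273147469"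
proof (rule near_powr_upper[OF assms _ _ ln_z(2)[OF assms]])
  show "exp_upper 2841029800174301403091464329 \<le> 786267778087508773053273147469" by (simp add: exp_eval)
qed simp_all

lemma powr_x1_above_beta:
  assumes "near x1 896666659861169072589015624884"
  shows "real 126813324309855516527732792870905 \<le> 2 ^ 96 * x1 powr (304083599541916779075 / 10 ^ 20)"
proof (rule near_powr_lower[OF assms _ _ ln_x1(1)[OF assms]])
  show "126813324309855516527732792870905 \<le> exp_lower 9133694393913678821664416966" by (simp add: exp_eval)
qed simp_all

lemma powr_x2_above_beta:
  assumes "near x2 384581579442840071834468499745"
  shows "real 9665497400059960454423821421048 \<le> 2 ^ 96 * x2 powr (304083599541916779075 / 10 ^ 20)"
proof (rule near_powr_lower[OF assms _ _ ln_x2(1)[OF assms]])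
  show "9665497400059960454423821421048 \<le> exp_lower 5947046656505096741210403824" by (simp add: exp_eval)
qed simp_all

lemma powr_x3_above_beta:
  assumes "near x3 104098411726227601361457464583"
  shows "real 181725069126606824662392293526 \<le> 2 ^ 96 * x3 powr (304083599541916779075 / 10 ^ 20)"
proof (rule near_powr_lower[OF assms _ _ ln_x3(1)[OF assms]])
  show "181725069126606824662392293526 \<le> exp_lower 1027692156530344269930976189" by (simp add: exp_eval)
qed simp_all

lemma powr_y1_above_beta:
  assumes "near y1 894949500035303817866630367303"
  shows "2 ^ 96 * y1 powr (304083599541916779075 / 10 ^ 20) \<le> real 126076288412840361490395683201534"
proof (rule near_powr_upper[OF assms _ _ ln_y1(2)[OF assms]])
  show "exp_upper 9126478527505882535106184905 \<le> 126076288412840361490395683201534" by (simp add: exp_eval)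
qed simp_all

lemma powr_y2_above_beta:
  assumes "near y2 396140812571321687967719751680"
  shows "2 ^ 96 * y2 powr (304083599541916779075 / 10 ^ 20) \<le> real 10576274951504690102616526422672"
proof (rule near_powr_upper[OF assms _ _ ln_y2(2)[OF assms]])
  show "exp_upper 6058524029874008992955802908 \<le> 10576274951504690102616526422672" by (simp add: exp_eval)
qed simp_all

lemma powr_z_above_beta:
  assumes "near z 168518775482488290804508497171"
  shows "real 786267778087508773112613975964 \<le> 2 ^ 96 * z powr (304083599541916779075 / 10 ^ 20)"
proof (rule near_powr_lower[OF assms _ _ ln_z(1)[OF assms]])
  show "786267778087508773112613975964 \<le> exp_lower 2841029800174301403184893554" by (simp add: exp_eval)
qed simp_all

section \<open>Signs of the energy difference\<close>

text \<open>\<open>S\<close> is the common fixed-point scale. As \<open>w\<close> bounds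
  \<open>S * b3\<close> from below, \<open>S * S / w\<close> bounds \<open>S * inverse b3\<close>
  from above, which reduces the claim to a comparison of numerals.\<close>

lemma scaled_gap_pos:
  fixes S :: real
  assumes "0 < S" "real v1 \<le> S * a1" "real v2 \<le> S * a2" "real v3 \<le> S * a3"
    "S * b1 \<le> real u1" "S * b2 \<le> real u2" "real w \<le> S * b3" "0 < w"
    "real u1 + real u2 + S * S / real w < real v1 + real v2 + real v3"
  shows "0 < a1 + a2 + a3 - b1 - b2 - inverse b3"
proof -
  have pos: "0 < S * b3" using assms(7,8) by linarith
  have "S * inverse b3 = S * S / (S * b3)"
    using assms(1) by (simp add: field_simps)
  also have "\<dots> \<le> S * S / real w"
    using assms(7,8) pos by (intro divide_left_mono mult_pos_pos[OF pos]) simp_all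
  finally have "0 < S * (a1 + a2 + a3 - b1 - b2 - inverse b3)"
    using assms(2-6,9) by (simp add: right_diff_distrib distrib_left)
  then show ?thesis
    using assms(1) by (simp add: zero_less_mult_iff)
qed

lemma scaled_gap_neg:
  fixes S :: real
  assumes "0 < S" "S * a1 \<le> real v1" "S * a2 \<le> real v2" "S * a3 \<le> real v3"
    "real u1 \<le> S * b1" "real u2 \<le> S * b2" "S * b3 \<le> real w" "0 < b3"
    "real v1 + real v2 + real v3 < real u1 + real u2 + S * S / real w"
  shows "a1 + a2 + a3 - b1 - b2 - inverse b3 < 0"
proof -
  have pos: "0 < S * b3" using assms(1,8) by simp
  then have "0 < real w" using assms(7) by linarith
  then have "S * S / real w \<le> S * S / (S * b3)"
    using assms(7) by (intro divide_left_mono mult_pos_pos[OF _ pos]) simp_all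
  also have "\<dots> = S * inverse b3"
    using assms(1) by (simp add: field_simps)
  finally have "S * (a1 + a2 + a3 - b1 - b2 - inverse b3) < 0"
    using assms(2-6,9) by (simp add: right_diff_distrib distrib_left)
  then show ?thesis
    using assms(1) by (simp add: mult_less_0_iff)
qed

text \<open>The pattern \<open>+ - - +\<close> traps one zero in each of the two short
  intervals.\<close>

lemma energy_gap_signs:
  assumes near: "near x1 896666659861169072589015624884" "near x2 384581579442840071834468499745"
    "near x3 104098411726227601361457464583"
    "near y1 894949500035303817866630367303" "near y2 396140812571321687967719751680"
    "near z 168518775482488290804508497171"
  shows "0 < energy_gap x1 x2 x3 y1 y2 (inverse z) (243225193382176085775 / 10 ^ 20)"
    "energy_gap x1 x2 x3 y1 y2 (inverse z) (243225193382176085785 / 10 ^ 20) < 0"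
    "energy_gap x1 x2 x3 y1 y2 (inverse z) (304083599541916779065 / 10 ^ 20) < 0"
    "0 < energy_gap x1 x2 x3 y1 y2 (inverse z) (304083599541916779075 / 10 ^ 20)"
proof -
  have z: "0 < z" using near_pos[OF near(6)] by simp
  then have inverse: "inverse z powr p = inverse (z powr p)" for p
    by (simp add: powr_def ln_inverse exp_minus)
  show "0 < energy_gap x1 x2 x3 y1 y2 (inverse z) (243225193382176085775 / 10 ^ 20)"
    unfolding energy_gap_def inverse
    by (rule scaled_gap_pos[OF _ powr_x1_below_alpha[OF near(1)]
        powr_x2_below_alpha[OF near(2)] powr_x3_below_alpha[OF near(3)]
        powr_y1_below_alpha[OF near(4)] powr_y2_below_alpha[OF near(5)] powr_z_below_alpha[OF near(6)]]) simp_all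
  show "energy_gap x1 x2 x3 y1 y2 (inverse z) (243225193382176085785 / 10 ^ 20) < 0"
    unfolding energy_gap_def inverse
    by (rule scaled_gap_neg[OF _ powr_x1_above_alpha[OF near(1)]
        powr_x2_above_alpha[OF near(2)] powr_x3_above_alpha[OF near(3)]
        powr_y1_above_alpha[OF near(4)] powr_y2_above_alpha[OF near(5)]
        powr_z_above_alpha[OF near(6)]]) (use z in simp_all)
  show "energy_gap x1 x2 x3 y1 y2 (inverse z) (304083599541916779065 / 10 ^ 20) < 0"
    unfolding energy_gap_def inverse
    by (rule scaled_gap_neg[OF _ powr_x1_below_beta[OF near(1)]
        powr_x2_below_beta[OF near(2)] powr_x3_below_beta[OF near(3)]
        powr_y1_below_beta[OF near(4)] powr_y2_below_beta[OF near(5)]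
        powr_z_below_beta[OF near(6)]]) (use z in simp_all)
  show "0 < energy_gap x1 x2 x3 y1 y2 (inverse z) (304083599541916779075 / 10 ^ 20)"
    unfolding energy_gap_def inverse
    by (rule scaled_gap_pos[OF _ powr_x1_above_beta[OF near(1)]
        powr_x2_above_beta[OF near(2)] powr_x3_above_beta[OF near(3)]
        powr_y1_above_beta[OF near(4)] powr_y2_above_beta[OF near(5)] powr_z_above_beta[OF near(6)]]) simp_all
qed

section \<open>The two graphs\<close>

text \<open>The third root of the cubic, \<open>8 - y1 - y3\<close>, is negative by the bounds, so
  only \<open>y1\<close>, \<open>5\<close> and \<open>y3\<close> count; the bounds also make them
  distinct.\<close>

lemma positive_energy_G0:
  fixes G :: "'a pair_pre_digraph"
  assumes fin: "finite (pverts G)"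
    and char: "char_poly (adjacency_matrix G) = [:1, 1:] ^ 12 * ([:-5, -4, 1:] * [:20, -39, -8, 1:])"
    and roots: "poly [:20, -39, -8, 1:] y1 = 0" "poly [:20, -39, -8, 1:] y3 = 0"
    and bounds: "8 < y1" "0 < y3" "y3 < 5"
  shows "positive_energy p G = y1 powr p + 5 powr p + y3 powr p"
proof -
  have cubic: "[:20, -39, -8, 1:] = [:y1 + y3 + -8, 1:] * ([:- y1, 1:] * [:- y3, 1:])"
    using roots bounds by (intro cubic_factor) auto
  have quadratic: "[:-5, -4, 1:] = [:1, 1:] * [:-5, 1::real:]"
    by simp
  have "char_poly (adjacency_matrix G) =
      ([:1, 1:] ^ 12 * ([:1, 1:] * [:y1 + y3 + -8, 1:])) * (\<Prod>r\<in>{y1, 5, y3}. [:- r, 1:])"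
    unfolding char cubic quadratic using bounds by (simp add: mult_ac del: mult_pCons_left mult_pCons_right)
  moreover have "poly ([:1, 1:] ^ 12 * ([:1, 1:] * [:y1 + y3 + -8, 1:])) x \<noteq> 0" if "0 < x" for x
    using that bounds by (auto simp del: mult_pCons_left mult_pCons_right)
  ultimately have "positive_energy p G = (\<Sum>r\<in>{y1, 5, y3}. r powr p)"
    using bounds by (intro positive_energy_eq[OF fin]) auto
  then show ?thesis
    using bounds by simp
qed

text \<open>The remaining roots \<open>3 - x2\<close> and \<open>9 - x1 - x3\<close> are negative by
  the bounds, which also separate the three positive ones.\<close>

lemma positive_energy_G1:
  fixes G :: "'a pair_pre_digraph"
  assumes fin: "finite (pverts G)"
    and char: "char_poly (adjacency_matrix G) = [:1, 1:] ^ 12 * ([:-9, -3, 1:] * [:54, -31, -9, 1:])"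
    and roots: "poly [:54, -31, -9, 1:] x1 = 0" "poly [:-9, -3, 1:] x2 = 0" "poly [:54, -31, -9, 1:] x3 = 0"
    and bounds: "9 < x1" "3 < x2" "x2 < 9" "0 < x3" "x3 < 3"
  shows "positive_energy p G = x1 powr p + x2 powr p + x3 powr p"
proof -
  have cubic: "[:54, -31, -9, 1:] = [:x1 + x3 + -9, 1:] * ([:- x1, 1:] * [:- x3, 1:])"
    using roots bounds by (intro cubic_factor) auto
  have quadratic: "[:-9, -3, 1:] = [:x2 + -3, 1:] * [:- x2, 1:]"
    by (rule quadratic_factor[OF roots(2)])
  have "char_poly (adjacency_matrix G) =
      ([:1, 1:] ^ 12 * ([:x2 + -3, 1:] * [:x1 + x3 + -9, 1:])) * (\<Prod>r\<in>{x1, x2, x3}. [:- r, 1:])"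
    unfolding char cubic quadratic using bounds by (simp add: mult_ac del: mult_pCons_left mult_pCons_right)
  moreover have "poly ([:1, 1:] ^ 12 * ([:x2 + -3, 1:] * [:x1 + x3 + -9, 1:])) x \<noteq> 0" if "0 < x" for x
    using that bounds by (auto simp del: mult_pCons_left mult_pCons_right)
  ultimately have "positive_energy p G = (\<Sum>r\<in>{x1, x2, x3}. r powr p)"
    using bounds by (intro positive_energy_eq[OF fin]) auto
  then show ?thesis
    using bounds by simp
qed

lemma energy_crossings:
  obtains x1 x2 x3 y1 y3 :: real
  where "poly [:54, -31, -9, 1:] x1 = 0" "poly [:-9, -3, 1:] x2 = 0" "poly [:54, -31, -9, 1:] x3 = 0"
    and "poly [:20, -39, -8, 1:] y1 = 0" "poly [:20, -39, -8, 1:] y3 = 0"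
    and "9 < x1" "3 < x2" "x2 < 9" "0 < x3" "x3 < 3" "8 < y1" "0 < y3" "y3 < 5"
    and "\<exists>\<alpha>\<in>{243225193382176085775 / 10 ^ 20<..<243225193382176085785 / 10 ^ 20}.
      \<exists>\<beta>\<in>{304083599541916779065 / 10 ^ 20<..<304083599541916779075 / 10 ^ 20}.
      \<forall>p>0. energy_gap x1 x2 x3 y1 5 y3 p < 0 \<longleftrightarrow> \<alpha> < p \<and> p < \<beta>"
proof -
  obtain x1 where x1: "near x1 896666659861169072589015624884" "poly [:54, -31, -9, 1:] x1 = 0"
    using near_root[of "[:54, -31, -9, 1:]" 896666659861169072589015624884] by auto
  obtain x2 where x2: "near x2 384581579442840071834468499745" "poly [:-9, -3, 1:] x2 = 0"
    using near_root[of "[:-9, -3, 1:]" 384581579442840071834468499745] by auto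
  obtain x3 where x3: "near x3 104098411726227601361457464583" "poly [:54, -31, -9, 1:] x3 = 0"
    using near_root[of "[:54, -31, -9, 1:]" 104098411726227601361457464583] by auto
  obtain y1 where y1: "near y1 894949500035303817866630367303" "poly [:20, -39, -8, 1:] y1 = 0"
    using near_root[of "[:20, -39, -8, 1:]" 894949500035303817866630367303] by auto
  \<comment> \<open>The coefficients of the cubic for \<open>y3\<close> are reversed here, so its
    roots are the inverses.\<close>
  obtain z where z: "near z 168518775482488290804508497171" "poly [:1, -8, -39, 20:] z = 0"
    using near_root[of "[:1, -8, -39, 20:]" 168518775482488290804508497171] by auto
  have y2: "near 5 396140812571321687967719751680"
    by (simp add: near_def)
  \<comment> \<open>These coarse bounds suffice to order the bases as
    \<open>inverse z < x3 < x2 < 5 < y1 < x1\<close>.\<close>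
  have bounds: "11.317 < x1" "4.85 < x2" "x2 < 4.86" "1.31 < x3" "x3 < 1.32"
    "11.29 < y1" "y1 < 11.3" "2.12 < z" "z < 2.13"
    using near_bounds[OF x1(1)] near_bounds[OF x2(1)] near_bounds[OF x3(1)] near_bounds[OF y1(1)]
      near_bounds[OF z(1)] by simp_all
  have y3: "0.4 < inverse z" "inverse z < 0.5"
    using bounds(8,9) by (simp_all add: field_simps)
  have "poly [:20, -39, -8, 1:] (inverse z) = poly [:1, -8, -39, 20:] z * inverse z ^ 3"
    using bounds(8) by (simp add: field_simps power3_eq_cube)
  then have y3_root: "poly [:20, -39, -8, 1:] (inverse z) = 0"
    using z(2) by simp
  have "\<exists>\<alpha>\<in>{243225193382176085775 / 10 ^ 20<..<243225193382176085785 / 10 ^ 20}.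
      \<exists>\<beta>\<in>{304083599541916779065 / 10 ^ 20<..<304083599541916779075 / 10 ^ 20}.
      \<forall>p>0. energy_gap x1 x2 x3 y1 5 (inverse z) p < 0 \<longleftrightarrow> \<alpha> < p \<and> p < \<beta>"
  proof (rule negative_between_zeros)
    show "continuous_on UNIV (energy_gap x1 x2 x3 y1 5 (inverse z))"
      unfolding energy_gap_def using bounds y3 by (intro continuous_intros) auto
    show "energy_gap x1 x2 x3 y1 5 (inverse z) 0 = 0"
      using bounds y3 by (simp add: energy_gap_def)
    show "\<exists>p\<in>{q, r, s, t}. energy_gap x1 x2 x3 y1 5 (inverse z) p \<noteq> 0"
      if "q < r" "r < s" "s < t" for q r s t
      using that bounds y3 by (intro energy_gap_no_four_zeros) simp_all
  qed (use energy_gap_signs[OF x1(1) x2(1) x3(1) y1(1) y2 z(1)] in simp_all)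
  then show ?thesis
    using that[OF x1(2) x2(2) x3(2) y1(2) y3_root] bounds y3 by simp
qed

theorem theorem2:
  fixes G0 G1 :: "'a pair_pre_digraph" and C1 C2 C3 :: "'a set" and u v :: 'a
  assumes "pair_graph G0"
    and "pverts G0 = C1 \<union> C2 \<union> C3 \<union> {u, v}"
    and "card C1 = 5" "card C2 = 5" "card C3 = 5"
    and "C1 \<inter> C2 = {}" "C1 \<inter> C3 = {}" "C2 \<inter> C3 = {}"
    and "u \<notin> C1 \<union> C2 \<union> C3" "v \<notin> C1 \<union> C2 \<union> C3" "u \<noteq> v"
    and "\<forall>C \<in> {C1, C2, C3}. \<forall>x \<in> C. \<forall>y \<in> C. x \<noteq> y \<longrightarrow> (x, y) \<in> parcs G0"
    and "\<forall>x \<in> C1. \<forall>y \<in> C2. (x, y) \<in> parcs G0"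
    and "\<forall>x \<in> C2. \<forall>y \<in> C3. (x, y) \<in> parcs G0"
    and "\<forall>x \<in> C1. \<forall>y \<in> C3. (x, y) \<notin> parcs G0"
    and "{x. (u, x) \<in> parcs G0} = C1"
    and "{x. (v, x) \<in> parcs G0} = C3"
    and "G1 = add_edge G0 u v"
  shows "\<exists>\<alpha> \<in> {2<..<3}. \<exists>\<beta> \<in> {3<..<4}.
           (\<forall>p \<ge> 1. positive_energy p G1 < positive_energy p G0 \<longleftrightarrow> \<alpha> < p \<and> p < \<beta>) \<and>
           (\<forall>\<alpha>' \<in> {2<..<3}. \<forall>\<beta>' \<in> {3<..<4}.
              (\<forall>p \<ge> 1. positive_energy p G1 < positive_energy p G0 \<longleftrightarrow> \<alpha>' < p \<and> p < \<beta>')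
              \<longrightarrow> \<alpha>' = \<alpha> \<and> \<beta>' = \<beta>) \<and>
           \<bar>\<alpha> - 2.4322519338217608578\<bar> \<le> 1 / 2 * (1 / 10 ^ 19) \<and>
           \<bar>\<beta> - 3.0408359954191677907\<bar> \<le> 1 / 2 * (1 / 10 ^ 19)"
proof -
  interpret pair_graph G0 by (rule assms(1))
  have sym: "(y, x) \<in> parcs G0" if "(x, y) \<in> parcs G0" for x y
    using that pair_sym_arcs by (auto simp: symmetric_def sym_def)
  have arcs_u: "(u, y) \<in> parcs G0 \<longleftrightarrow> y \<in> C1" "(y, u) \<in> parcs G0 \<longleftrightarrow> y \<in> C1" for y
    using assms(16) sym by blast+
  have arcs_v: "(v, y) \<in> parcs G0 \<longleftrightarrow> y \<in> C3" "(y, v) \<in> parcs G0 \<longleftrightarrow> y \<in> C3" for y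
    using assms(17) sym by blast+
  have loop: "(x, x) \<notin> parcs G0" for x
    using pair_no_loops by fastforce
  have clique: "(x, y) \<in> parcs G0 \<longleftrightarrow> x \<noteq> y" if "x \<in> C" "y \<in> C" "C \<in> {C1, C2, C3}" for x y C
    using that assms(12) loop by metis
  have path: "(x, y) \<in> parcs G0" "(y, x) \<in> parcs G0"
    if "x \<in> C1 \<and> y \<in> C2 \<or> x \<in> C2 \<and> y \<in> C3" for x y
    using that assms(13,14) sym by blast+
  have non_arcs: "(x, y) \<notin> parcs G0" "(y, x) \<notin> parcs G0" if "x \<in> C1" "y \<in> C3" for x y
    using that assms(15) sym by blast+
  define \<kappa> :: "'a \<Rightarrow> nat" where
    "\<kappa> x = (if x \<in> C1 then 0 else if x \<in> C2 then 1 else if x \<in> C3 then 2 else if x = u then 3 else 4)" for x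
  have class_of: "x \<in> C1 \<and> \<kappa> x = 0 \<or> x \<in> C2 \<and> \<kappa> x = 1 \<or> x \<in> C3 \<and> \<kappa> x = 2 \<or> x = u \<and> \<kappa> x = 3 \<or> x = v \<and> \<kappa> x = 4"
    if "x \<in> pverts G0" for x
    using that assms(2,6-11) unfolding \<kappa>_def by auto
  \<comment> \<open>One case distinction over the classes of \<open>x\<close> and \<open>y\<close>
    serves both graphs; \<open>e = 1\<close> adds the two arcs joining \<open>u\<close> and
    \<open>v\<close>.\<close>
  have adj: "of_bool ((x, y) \<in> parcs G0 \<or> e = 1 \<and> (x, y) \<in> {(u, v), (v, u)}) + of_bool (x = y) =
      quotient_weight e (\<kappa> x) (\<kappa> y)"
    if "x \<in> pverts G0" "y \<in> pverts G0" "e = 0 \<or> e = 1" for x y e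
    using class_of[OF that(1)] class_of[OF that(2)] that(3) assms(6-11)
    by (elim disjE conjE) (auto simp: quotient_weight_def doubleton_eq_iff arcs_u arcs_v loop path non_arcs clique)
  have G1: "pverts G1 = pverts G0" "parcs G1 = parcs G0 \<union> {(u, v), (v, u)}"
    by (simp_all add: assms(18) add_edge_def)
  have adj0: "of_bool ((x, y) \<in> parcs G0) + of_bool (x = y) = quotient_weight 0 (\<kappa> x) (\<kappa> y)"
    if "x \<in> pverts G0" "y \<in> pverts G0" for x y
    using adj[OF that, of 0] by simp
  have adj1: "of_bool ((x, y) \<in> parcs G1) + of_bool (x = y) = quotient_weight 1 (\<kappa> x) (\<kappa> y)"
    if "x \<in> pverts G1" "y \<in> pverts G1" for x y
    using adj[OF that[unfolded G1(1)], of 1] unfolding G1(2) by (simp only: Un_iff simp_thms)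
  have char0: "char_poly (adjacency_matrix G0) = [:1, 1:] ^ 12 * ([:-5, -4, 1:] * [:20, -39, -8, 1:])"
    by (rule char_poly_clique_path(1)[OF assms(2-11) _ refl]) (rule adj0[unfolded \<kappa>_def])
  have char1: "char_poly (adjacency_matrix G1) = [:1, 1:] ^ 12 * ([:-9, -3, 1:] * [:54, -31, -9, 1:])"
    by (rule char_poly_clique_path(2)[OF assms(2)[folded G1(1)] assms(3-11) _ refl])
      (rule adj1[unfolded \<kappa>_def])
  obtain x1 x2 x3 y1 y3 where xs: "poly [:54, -31, -9, 1:] x1 = 0" "poly [:-9, -3, 1:] x2 = 0"
      "poly [:54, -31, -9, 1:] x3 = 0" "9 < x1" "3 < x2" "x2 < 9" "0 < x3" "x3 < 3"
    and ys: "poly [:20, -39, -8, 1:] y1 = 0" "poly [:20, -39, -8, 1:] y3 = 0" "8 < y1" "0 < y3" "y3 < 5"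
    and "\<exists>\<alpha>\<in>{243225193382176085775 / 10 ^ 20<..<243225193382176085785 / 10 ^ 20}.
      \<exists>\<beta>\<in>{304083599541916779065 / 10 ^ 20<..<304083599541916779075 / 10 ^ 20}.
      \<forall>p>0. energy_gap x1 x2 x3 y1 5 y3 p < 0 \<longleftrightarrow> \<alpha> < p \<and> p < \<beta>"
    by (rule energy_crossings)
  then obtain \<alpha> \<beta> where
    \<alpha>: "243225193382176085775 / 10 ^ 20 < \<alpha>" "\<alpha> < 243225193382176085785 / 10 ^ 20"
    and \<beta>: "304083599541916779065 / 10 ^ 20 < \<beta>" "\<beta> < 304083599541916779075 / 10 ^ 20"
    and gap: "\<And>p. 0 < p \<Longrightarrow> energy_gap x1 x2 x3 y1 5 y3 p < 0 \<longleftrightarrow> \<alpha> < p \<and> p < \<beta>"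
    by auto
  have "positive_energy p G1 - positive_energy p G0 = energy_gap x1 x2 x3 y1 5 y3 p" for p
    using positive_energy_G0[OF _ char0 ys] positive_energy_G1[OF _ char1 xs(1-8)] pair_finite_verts G1(1)
    by (simp add: energy_gap_def)
  then have energy: "positive_energy p G1 < positive_energy p G0 \<longleftrightarrow> \<alpha> < p \<and> p < \<beta>" if "1 \<le> p" for p
    using gap[of p] that by (smt (verit))
  have unique: "\<alpha>' = \<alpha> \<and> \<beta>' = \<beta>"
    if "\<alpha>' \<in> {2<..<3}" "\<beta>' \<in> {3<..<4}"
      "\<forall>p \<ge> 1. positive_energy p G1 < positive_energy p G0 \<longleftrightarrow> \<alpha>' < p \<and> p < \<beta>'" for \<alpha>' \<beta>'
  proof -
    \<comment> \<open>The equivalences speak only of \<open>p \<ge> 1\<close>, but both left end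
      points exceed 2, so smaller \<open>p\<close> lie in neither interval. A nonempty open interval
      determines its end points.\<close>
    have "{\<alpha>'<..<\<beta>'} = {\<alpha><..<\<beta>}"
    proof (rule Set.set_eqI)
      fix p
      show "p \<in> {\<alpha>'<..<\<beta>'} \<longleftrightarrow> p \<in> {\<alpha><..<\<beta>}"
        using that energy[of p] \<alpha>(1) by (cases "1 \<le> p") auto
    qed
    then show ?thesis
      using that(1,2) by (subst (asm) greaterThanLessThan_eq_iff) auto
  qed
  show ?thesis
  proof (intro bexI conjI)
    show "\<alpha> \<in> {2<..<3}" "\<beta> \<in> {3<..<4}"
      using \<alpha> \<beta> by simp_all
    \<comment> \<open>The enclosing intervals extend exactly half of \<open>1 / 10 ^ 19\<close> to
      each side of the stated decimals.\<close>
    show "\<bar>\<alpha> - 2.4322519338217608578\<bar> \<le> 1 / 2 * (1 / 10 ^ 19)"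
      "\<bar>\<beta> - 3.0408359954191677907\<bar> \<le> 1 / 2 * (1 / 10 ^ 19)"
      using \<alpha> \<beta> unfolding abs_le_iff by simp_all
  qed (use energy unique in blast)+
qed

end
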